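(* Let $\gamma=\frac{\sqrt5+1}{2}$ and $i=\sqrt{-1}$. Let $T$ be the uniform random spanning tree of the helix-3-graph $G^{H_3}$ and $X_m=\mathbf{1}_{\{z_m\in T\}}$, $m\in\mathbb{Z}$. (i) The process $X=(X_m)_{m\in\mathbb{Z}}$ is a determinantal point process with (real-valued symmetric Toeplitz) matrix $A_{k,l}=\widehat f(l-k)$ given by $$\widehat f(m)=\eta\,\alpha^{|m|}+\bar\eta\,\bar\alpha^{|m|},\qquad m\in\mathbb{Z},$$ where $$\eta=\frac{\gamma^{3/2}}{4\sqrt5}+i\,\frac{\gamma^{-3/2}}{4\sqrt5}\qquad\text{and}\qquad \alpha=\frac{\gamma^{-3/2}-1}{2}+i\,\frac{\gamma^{3/2}-1}{2}.$$ (ii) The Fourier transform $f$ of $\widehat f$ equals $$f(x)=\frac{1}{4+4\cos(2\pi x)+2\cos(4\pi x)}.$$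
   Context: Helix-3-graph $G^{H_3}$: vertex set $\mathbb{Z}$, edges $z_m=\{m-1,m\}$ and $h_m=\{m-3,m\}$ for $m\in\mathbb{Z}$. For $m\le n$, $G^{H_3}_{m,n}$ is the subgraph induced by $\{m,\dots,n\}$. The uniform spanning tree measure $\mathbf{P}$ on $G^{H_3}$ is the limit as $n\to\infty$ of the uniform distributions on the spanning trees of $G^{H_3}_{-n,n}$ (the limit exists, in the sense of convergence of probabilities of events depending on finitely many edges, and is concentrated on spanning trees of $G^{H_3}$). A $\{0,1\}^{\mathbb{Z}}$-valued process $X$ is a determinantal point process with matrix $A$ (Hermitian, indexed by $\mathbb{Z}$) if $\mathbf{P}[X_s=1\text{ for all }s\in S]=\det((A_{ij})_{i,j\in S})$ for all finite $S\subset\mathbb{Z}$. The Fourier transform of $\widehat f$ (or of the Toeplitz matrix $A$) is the function $f:[0,1]\to[0,1]$ with $\widehat f(k)=\int_0^1f(x)e^{-2\pi ikx}\,dx$ for all $k\in\mathbb{Z}$. *)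

theory Defs
  imports "HOL-Probability.Probability" "Jordan_Normal_Form.Determinant"
begin

text \<open>
  A graph is a pair of a vertex set and a set of undirected edges, an edge being the set of its
  endpoints. Spanning trees are identified with their edge sets. (The notion of tree in the entry
  \<open>Graph_Theory\<close> is not suitable: there a symmetric digraph has directed cycles of length two.)
\<close>

type_synonym 'v edge = "'v set"
type_synonym 'v graph = "'v set \<times> 'v edge set"

definition induced_subgraph :: "'v graph \<Rightarrow> 'v set \<Rightarrow> 'v graph" where
  "induced_subgraph G W = (fst G \<inter> W, {e \<in> snd G. e \<subseteq> W})"

definition connected_graph :: "'v graph \<Rightarrow> bool" where
  "connected_graph G \<longleftrightarrow> (\<forall>u\<in>fst G. \<forall>v\<in>fst G. (u, v) \<in> {(x, y). {x, y} \<in> snd G}\<^sup>*)"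

definition acyclic_graph :: "'v graph \<Rightarrow> bool" where
  "acyclic_graph G \<longleftrightarrow>
     \<not> (\<exists>vs. 3 \<le> length vs \<and> distinct vs \<and>
          (\<forall>i<length vs. {vs ! i, vs ! (Suc i mod length vs)} \<in> snd G))"

definition spanning_trees :: "'v graph \<Rightarrow> 'v edge set set" where
  "spanning_trees G =
     {t. t \<subseteq> snd G \<and> connected_graph (fst G, t) \<and> acyclic_graph (fst G, t)}"

definition z_edge :: "int \<Rightarrow> int edge" where "z_edge m = {m - 1, m}"
definition h_edge :: "int \<Rightarrow> int edge" where "h_edge m = {m - 3, m}"

definition helix3 :: "int graph" where
  "helix3 = (UNIV, range z_edge \<union> range h_edge)"

definition helix3_sub :: "int \<Rightarrow> int \<Rightarrow> int graph" where
  "helix3_sub m n = induced_subgraph helix3 {m..n}"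

text \<open>
  \<open>T\<close> is a random set of edges of the infinite graph whose law is the limit of the uniform
  distributions on the spanning trees of the finite subgraphs: for a finite set \<open>F\<close> of edges,
  the events depending only on \<open>F\<close> are the events \<open>T \<inter> F \<in> B\<close>. This determines the law of \<open>T\<close>;
  that \<open>T\<close> is almost surely a spanning tree is a consequence and is not required here.
\<close>

definition helix3_ust :: "'a measure \<Rightarrow> ('a \<Rightarrow> int edge set) \<Rightarrow> bool" where
  "helix3_ust M T \<longleftrightarrow>
     (\<forall>\<omega>\<in>space M. T \<omega> \<subseteq> snd helix3) \<and>
     (\<forall>e\<in>snd helix3. {\<omega>\<in>space M. e \<in> T \<omega>} \<in> sets M) \<and>
     (\<forall>F B. finite F \<longrightarrow> F \<subseteq> snd helix3 \<longrightarrow>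
        (\<lambda>n. measure_pmf.prob (pmf_of_set (spanning_trees (helix3_sub (- int n) (int n))))
               {t. t \<inter> F \<in> B})
          \<longlonglongrightarrow> measure M {\<omega>\<in>space M. T \<omega> \<inter> F \<in> B})"

text \<open>
  The matrix \<open>(A i j)\<close> with \<open>i, j \<in> S\<close>, with rows and columns listed in increasing order.
\<close>

definition restricted_matrix :: "(int \<Rightarrow> int \<Rightarrow> complex) \<Rightarrow> int set \<Rightarrow> complex mat" where
  "restricted_matrix A S =
     Matrix.mat (card S) (card S)
       (\<lambda>(i, j). A (sorted_list_of_set S ! i) (sorted_list_of_set S ! j))"

definition determinantal_process ::
    "'a measure \<Rightarrow> (int \<Rightarrow> 'a \<Rightarrow> nat) \<Rightarrow> (int \<Rightarrow> int \<Rightarrow> complex) \<Rightarrow> bool" where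
  "determinantal_process M X A \<longleftrightarrow>
     (\<forall>m. X m \<in> measurable M (count_space {0, 1})) \<and>
     (\<forall>i j. A j i = cnj (A i j)) \<and>
     (\<forall>S. finite S \<longrightarrow>
        complex_of_real (measure M {\<omega>\<in>space M. \<forall>s\<in>S. X s \<omega> = 1})
          = Determinant.det (restricted_matrix A S))"

text \<open>
  The argument \<open>f\<close> is only relevant on the unit interval. Integrability of the case \<open>k = 0\<close>
  makes \<open>f\<close> Lebesgue measurable there, since \<open>f\<close> is nonnegative.
\<close>

definition is_fourier_transform :: "(real \<Rightarrow> real) \<Rightarrow> (int \<Rightarrow> complex) \<Rightarrow> bool" where
  "is_fourier_transform f fhat \<longleftrightarrow>
     (\<forall>x\<in>{0..1}. f x \<in> {0..1}) \<and>
     (\<forall>k. ((\<lambda>x. complex_of_real (f x) * exp (- (2 * pi * \<i> * of_int k * of_real x)))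
              has_integral fhat k) {0..1})"

end

theory Submission
  imports Defs
begin

text \<open>
  The proof computes the law of the tree in a finite box and lets the box grow.

  In the box \<open>{a..b}\<close> the edges \<open>z_j\<close> form a Hamiltonian path, hence a spanning tree, and every edge
  \<open>e = {p, q}\<close> with \<open>p < q\<close> has the coordinate vector \<open>v_e\<close>, the indicator of \<open>{p+1..q}\<close>, with respect
  to this tree. As many edges as the path has form a spanning tree iff the matrix of their vectors has
  determinant \<open>1\<close> or \<open>- 1\<close>, and otherwise this determinant vanishes. By the Cauchy-Binet formula the
  number of spanning trees is therefore the determinant of the Gram matrix \<open>M\<close>, the sum of the
  matrices \<open>v_e v_e\<^sup>T\<close> (\<open>matrix_tree_interval\<close>). Since \<open>z_s\<close> only enters row \<open>s\<close> of \<open>M\<close>, and with a unit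
  row, forcing \<open>z_s\<close> into the tree replaces row \<open>s\<close> by that unit row (\<open>matrix_tree_forced_edges\<close>).
  Dividing the two determinants shows that the edges \<open>z_s\<close> are determinantal in the box, with matrix
  \<open>B\<close> the inverse of \<open>M\<close> (\<open>prob_forced_edges\<close>).

  The edge \<open>h_m\<close> has coordinates \<open>1\<close> at \<open>m - 2, m - 1, m\<close>. So \<open>M\<close> agrees, except near the boundary of
  the box, with the Toeplitz matrix whose symbol is
  \<open>1 + \<bar>1 + w + w\<^sup>2\<bar>\<^sup>2 = 1 + (1 + 2 cos (2 \<pi> x))\<^sup>2 = 4 + 4 cos (2 \<pi> x) + 2 cos (4 \<pi> x)\<close>
  at \<open>w = exp (2 \<pi> \<i> x)\<close>, and one expects \<open>B\<close> to converge to the Toeplitz matrix whose symbol is the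
  reciprocal \<open>f\<close>. This is proved without spectral theory: the explicit sequence \<open>fhat\<close> solves the
  five-term recurrence given by the symbol of \<open>M\<close>, hence \<open>F M\<close>, for \<open>F\<close> the Toeplitz matrix of \<open>fhat\<close>,
  differs from the identity only near the boundary, where \<open>fhat\<close> is small. As \<open>M \<ge> 1\<close>, its inverse
  does not enlarge this error (\<open>finite_section_error\<close>, \<open>ust_helix3_limit\<close>).

  For the second part, \<open>\<alpha>\<close> and its conjugate are the two roots inside the unit circle of the
  polynomial belonging to the symbol, and the partial fraction decomposition of \<open>f\<close> in \<open>w\<close> consists
  of geometric series whose coefficients are the terms of \<open>fhat\<close> (\<open>partial_fractions\<close>). That \<open>f\<close> is
  the only function with these coefficients follows from Stone-Weierstrass on the circle
  (\<open>fourier_transform_unique\<close>).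
\<close>

section \<open>Determinants indexed by finite sets\<close>

text \<open>
  Rows and columns are indexed by an arbitrary set, so that the principal minor of \<open>A\<close> on \<open>S\<close> is
  just \<open>set_det S A\<close>, without any enumeration of \<open>S\<close>.
\<close>
definition set_det :: "'a set \<Rightarrow> ('a \<Rightarrow> 'a \<Rightarrow> 'b::comm_ring_1) \<Rightarrow> 'b" where
  "set_det I A = (\<Sum>p | p permutes I. of_int (sign p) * (\<Prod>i\<in>I. A i (p i)))"

lemma set_det_cong:
  assumes "\<And>i j. i \<in> I \<Longrightarrow> j \<in> I \<Longrightarrow> A i j = B i j"
  shows "set_det I A = set_det I B"
  unfolding set_det_def
  by (intro sum.cong refl arg_cong2[where f = "(*)"] prod.cong) (auto simp: assms permutes_in_image)

lemma set_det_permute_rows: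
  assumes "finite I" "q permutes I"
  shows "set_det I (\<lambda>i. A (q i)) = of_int (sign q) * set_det I A"
proof -
  have "set_det I (\<lambda>i. A (q i)) = (\<Sum>p | p permutes I. of_int (sign (p \<circ> q)) * (\<Prod>i\<in>I. A (q i) ((p \<circ> q) i)))"
    unfolding set_det_def
    by (rule sum.reindex_bij_witness[of _ "\<lambda>p. p \<circ> q" "\<lambda>p. p \<circ> inv_into UNIV q"])
       (use assms in \<open>auto simp: permutes_compose permutes_inv o_assoc[symmetric] permutes_inv_o\<close>)
  also have "\<dots> = (\<Sum>p | p permutes I. of_int (sign q) * (of_int (sign p) * (\<Prod>i\<in>I. A i (p i))))"
  proof (intro sum.cong refl)
    fix p assume "p \<in> {p. p permutes I}"
    then have p: "p permutes I" by simp
    have "sign (p \<circ> q) = sign p * sign q"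
      using assms p by (meson permutation_permutes sign_compose)
    moreover have "(\<Prod>i\<in>I. A (q i) ((p \<circ> q) i)) = (\<Prod>i\<in>I. A i (p i))"
      using prod.permute[OF assms(2), of "\<lambda>i. A i (p i)"] by (simp add: o_def)
    ultimately show "of_int (sign (p \<circ> q)) * (\<Prod>i\<in>I. A (q i) ((p \<circ> q) i))
        = of_int (sign q) * (of_int (sign p) * (\<Prod>i\<in>I. A i (p i)))"
      by (simp add: mult_ac)
  qed
  finally show ?thesis by (simp add: set_det_def sum_distrib_left)
qed

lemma set_det_transpose:
  assumes "finite I"
  shows "set_det I (\<lambda>i j. A j i) = set_det I A"
proof -
  have "set_det I (\<lambda>i j. A j i) = (\<Sum>p | p permutes I. of_int (sign (inv_into UNIV p)) * (\<Prod>i\<in>I. A (inv_into UNIV p i) i))"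
    unfolding set_det_def
    by (rule sum.reindex_bij_witness[of _ "inv_into UNIV" "inv_into UNIV"])
       (use assms in \<open>auto simp: permutes_inv permutes_inv_inv\<close>)
  also have "\<dots> = set_det I A"
    unfolding set_det_def
  proof (intro sum.cong refl)
    fix p assume "p \<in> {p. p permutes I}"
    then have p: "p permutes I" by simp
    have "sign (inv_into UNIV p) = sign p" using assms p by (meson permutation_permutes sign_inverse)
    moreover have "(\<Prod>i\<in>I. A (inv_into UNIV p i) i) = (\<Prod>i\<in>I. A i (p i))"
      using prod.permute[OF p, of "\<lambda>i. A (inv_into UNIV p i) i"] p by (simp add: o_def permutes_inverses)
    ultimately show "of_int (sign (inv_into UNIV p)) * (\<Prod>i\<in>I. A (inv_into UNIV p i) i) = of_int (sign p) * (\<Prod>i\<in>I. A i (p i))"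
      by simp
  qed
  finally show ?thesis .
qed

text \<open>Swapping the two rows changes the sign but not the matrix.\<close>
lemma set_det_identical_rows:
  fixes A :: "'a \<Rightarrow> 'a \<Rightarrow> 'b::{idom, ring_char_0}"
  assumes "finite I" "i \<in> I" "j \<in> I" "i \<noteq> j" "A i = A j"
  shows "set_det I A = 0"
proof -
  have "(\<lambda>k. A (Transposition.transpose i j k)) = A"
    using assms(5) by (auto simp: Transposition.transpose_def)
  then have "set_det I A = - set_det I A"
    using set_det_permute_rows[OF assms(1) permutes_swap_id[OF assms(2,3)], of A] assms(4)
    by (simp add: sign_swap_id)
  then show ?thesis by simp
qed

lemma set_det_row_diff:
  assumes "finite I" "s \<in> I"
    and "\<And>i. i \<in> I \<Longrightarrow> i \<noteq> s \<Longrightarrow> A i = C i \<and> B i = C i"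
    and "\<And>j. j \<in> I \<Longrightarrow> C s j = A s j - B s j"
  shows "set_det I C = set_det I A - set_det I B"
proof -
  have "(\<Prod>i\<in>I. C i (p i)) = (\<Prod>i\<in>I. A i (p i)) - (\<Prod>i\<in>I. B i (p i))" if "p permutes I" for p
  proof -
    have "(\<Prod>i\<in>I - {s}. A i (p i)) = (\<Prod>i\<in>I - {s}. C i (p i))"
         "(\<Prod>i\<in>I - {s}. B i (p i)) = (\<Prod>i\<in>I - {s}. C i (p i))"
      using assms(3) by (auto intro!: prod.cong)
    moreover have "p s \<in> I" using that assms(2) by (simp add: permutes_in_image)
    ultimately show ?thesis
      using assms(1,2) by (simp add: prod.remove[of I s] assms(4) algebra_simps)
  qed
  then show ?thesis
    by (simp add: set_det_def sum_subtractf[symmetric] right_diff_distrib)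
qed

text \<open>
  A permutation with a nonzero term has to fix every index whose row is a unit row; what remains
  are the permutations of \<open>S\<close>.
\<close>
lemma set_det_identity_rows:
  assumes "finite I" "S \<subseteq> I" "\<And>i j. i \<in> I - S \<Longrightarrow> j \<in> I \<Longrightarrow> A i j = of_bool (i = j)"
  shows "set_det I A = set_det S A"
proof -
  have "finite S" using assms finite_subset by blast
  have "set_det I A = (\<Sum>p | p permutes S. of_int (sign p) * (\<Prod>i\<in>I. A i (p i)))"
    unfolding set_det_def
  proof (rule sum.mono_neutral_right)
    show "finite {p. p permutes I}" using assms(1) by (rule finite_permutations)
    show "{p. p permutes S} \<subseteq> {p. p permutes I}" using assms(2) permutes_subset by blast
    show "\<forall>p\<in>{p. p permutes I} - {p. p permutes S}. of_int (sign p) * (\<Prod>i\<in>I. A i (p i)) = 0"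
    proof
      fix p assume p: "p \<in> {p. p permutes I} - {p. p permutes S}"
      then obtain i where i: "i \<notin> S" "p i \<noteq> i"
        using permutes_superset[of p I S] by blast
      then have "i \<in> I" using p by (auto simp: permutes_def)
      then have "A i (p i) = 0" using assms(3)[of i "p i"] i p by (auto simp: permutes_in_image)
      then have "(\<Prod>i\<in>I. A i (p i)) = 0" using assms(1) \<open>i \<in> I\<close> by (meson prod_zero)
      then show "of_int (sign p) * (\<Prod>i\<in>I. A i (p i)) = 0" by simp
    qed
  qed
  also have "\<dots> = set_det S A"
    unfolding set_det_def
  proof (intro sum.cong refl arg_cong2[where f = "(*)"])
    fix p assume "p \<in> {p. p permutes S}"
    then have "A i (p i) = 1" if "i \<in> I - S" for i
      using that assms(3)[of i i] permutes_not_in[of p S i] by auto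
    then show "(\<Prod>i\<in>I. A i (p i)) = (\<Prod>i\<in>S. A i (p i))"
      using assms(1,2) by (intro prod.mono_neutral_right) auto
  qed
  finally show ?thesis .
qed

text \<open>
  Expanding every row by multilinearity gives a sum over all choices \<open>f\<close> of one \<open>e \<in> E\<close> per row.
  Choices that are not injective give two equal rows. The injective ones are grouped by their range
  \<open>B\<close>: they differ from the fixed bijection \<open>b B\<close> by a permutation of \<open>I\<close>, whose sign turns the sum over
  the group into a second determinant.
\<close>
theorem Cauchy_Binet:
  fixes u :: "'a \<Rightarrow> 'e \<Rightarrow> 'b::{idom, ring_char_0}"
  assumes I: "finite I" and E: "finite E"
    and b: "\<And>B. B \<subseteq> E \<Longrightarrow> card B = card I \<Longrightarrow> bij_betw (b B) I B"
  shows "set_det I (\<lambda>i j. \<Sum>e\<in>E. u i e * w e j)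
       = (\<Sum>B | B \<subseteq> E \<and> card B = card I. set_det I (\<lambda>i j. u i (b B j)) * set_det I (\<lambda>i. w (b B i)))"
proof -
  let ?P = "\<lambda>f. (\<Prod>i\<in>I. u i (f i)) * set_det I (\<lambda>i. w (f i))"
  let ?D = "{B. B \<subseteq> E \<and> card B = card I}"
  have "set_det I (\<lambda>i j. \<Sum>e\<in>E. u i e * w e j)
      = (\<Sum>p | p permutes I. \<Sum>f\<in>I \<rightarrow>\<^sub>E E. of_int (sign p) * (\<Prod>i\<in>I. u i (f i) * w (f i) (p i)))"
    unfolding set_det_def by (simp add: prod_sum_PiE I E sum_distrib_left)
  also have "\<dots> = (\<Sum>f\<in>I \<rightarrow>\<^sub>E E. ?P f)"
    by (subst sum.swap) (simp add: set_det_def sum_distrib_left prod.distrib mult_ac)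
  also have "\<dots> = (\<Sum>f\<in>{f\<in>I \<rightarrow>\<^sub>E E. inj_on f I}. ?P f)"
  proof (rule sum.mono_neutral_right)
    show "finite (I \<rightarrow>\<^sub>E E)" using I E by (simp add: finite_PiE)
    show "\<forall>f\<in>(I \<rightarrow>\<^sub>E E) - {f \<in> I \<rightarrow>\<^sub>E E. inj_on f I}. ?P f = 0"
    proof
      fix f assume "f \<in> (I \<rightarrow>\<^sub>E E) - {f \<in> I \<rightarrow>\<^sub>E E. inj_on f I}"
      then obtain i j where "i \<in> I" "j \<in> I" "i \<noteq> j" "f i = f j" by (auto simp: inj_on_def)
      then have "set_det I (\<lambda>i. w (f i)) = 0" using I by (intro set_det_identical_rows[of I i j]) auto
      then show "?P f = 0" by simp
    qed
  qed auto
  also have "\<dots> = (\<Sum>B\<in>?D. \<Sum>f\<in>{f\<in>{f\<in>I \<rightarrow>\<^sub>E E. inj_on f I}. f ` I = B}. ?P f)"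
  proof (rule sum.group[symmetric])
    show "finite {f\<in>I \<rightarrow>\<^sub>E E. inj_on f I}" using I E by (simp add: finite_PiE)
    show "finite ?D" using E by simp
    show "(\<lambda>f. f ` I) ` {f\<in>I \<rightarrow>\<^sub>E E. inj_on f I} \<subseteq> ?D" by (auto simp: card_image)
  qed
  also have "\<dots> = (\<Sum>B\<in>?D. set_det I (\<lambda>i j. u i (b B j)) * set_det I (\<lambda>i. w (b B i)))"
  proof (intro sum.cong refl)
    fix B assume "B \<in> ?D"
    then have B: "B \<subseteq> E" and bB: "bij_betw (b B) I B" using b by auto
    let ?F = "{f\<in>{f\<in>I \<rightarrow>\<^sub>E E. inj_on f I}. f ` I = B}"
    have "(\<Sum>f\<in>?F. ?P f) = (\<Sum>q | q permutes I. ?P (restrict (b B \<circ> q) I))"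
    proof (rule sum.reindex_bij_witness[of _ "\<lambda>q. restrict (b B \<circ> q) I" "\<lambda>f. restrict_id (inv_into I (b B) \<circ> f) I"])
      fix f assume f: "f \<in> ?F"
      then have "bij_betw f I B" by (auto simp: bij_betw_def)
      then have "bij_betw (inv_into I (b B) \<circ> f) I I"
        using bij_betw_trans bij_betw_inv_into[OF bB] by blast
      then have "restrict_id (inv_into I (b B) \<circ> f) I permutes I"
        by (rule permutes_restrict_id)
      then show "restrict_id (inv_into I (b B) \<circ> f) I \<in> {q. q permutes I}" by simp
      show "restrict (b B \<circ> restrict_id (inv_into I (b B) \<circ> f) I) I = f"
      proof
        fix i show "restrict (b B \<circ> restrict_id (inv_into I (b B) \<circ> f) I) I i = f i"
        proof (cases "i \<in> I")
          case True
          then have "f i \<in> B" using f by auto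
          then show ?thesis using True bB
            by (auto simp: restrict_id_def bij_betw_def f_inv_into_f)
        next
          case False then show ?thesis using f by (auto simp: PiE_def extensional_def)
        qed
      qed
      then show "?P (restrict (b B \<circ> restrict_id (inv_into I (b B) \<circ> f) I) I) = ?P f" by simp
    next
      fix q assume "q \<in> {q. q permutes I}"
      then have q: "q permutes I" by simp
      have bq: "bij_betw (b B \<circ> q) I B" using bij_betw_trans[OF permutes_imp_bij[OF q] bB] .
      then have "inj_on (restrict (b B \<circ> q) I) I" "restrict (b B \<circ> q) I ` I = B"
        by (auto simp: bij_betw_def inj_on_def)
      then show "restrict (b B \<circ> q) I \<in> ?F" using B by auto
      show "restrict_id (inv_into I (b B) \<circ> restrict (b B \<circ> q) I) I = q"
        using q bB by (auto simp: restrict_id_def fun_eq_iff permutes_in_image permutes_not_in bij_betw_def)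
    qed
    also have "\<dots> = (\<Sum>q | q permutes I. of_int (sign q) * (\<Prod>i\<in>I. u i (b B (q i))) * set_det I (\<lambda>i. w (b B i)))"
    proof (intro sum.cong refl)
      fix q assume "q \<in> {q. q permutes I}"
      then have q: "q permutes I" by simp
      have "set_det I (\<lambda>i. w (restrict (b B \<circ> q) I i)) = set_det I (\<lambda>i. w (b B (q i)))"
        by (rule set_det_cong) auto
      also have "\<dots> = of_int (sign q) * set_det I (\<lambda>i. w (b B i))"
        using set_det_permute_rows[OF I q, of "\<lambda>i. w (b B i)"] .
      finally show "?P (restrict (b B \<circ> q) I) = of_int (sign q) * (\<Prod>i\<in>I. u i (b B (q i))) * set_det I (\<lambda>i. w (b B i))"
        by simp
    qed
    finally show "(\<Sum>f\<in>?F. ?P f) = set_det I (\<lambda>i j. u i (b B j)) * set_det I (\<lambda>i. w (b B i))"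
      by (simp add: set_det_def[of I "\<lambda>i j. u i (b B j)"] sum_distrib_right)
  qed
  finally show ?thesis .
qed

text \<open>For \<open>E = I\<close> the only range in the Cauchy-Binet formula is \<open>I\<close> itself.\<close>
lemma set_det_mult:
  fixes A :: "'a \<Rightarrow> 'a \<Rightarrow> 'b::{idom, ring_char_0}"
  assumes "finite I"
  shows "set_det I (\<lambda>i j. \<Sum>k\<in>I. A i k * B k j) = set_det I A * set_det I B"
proof -
  have D: "{B. B \<subseteq> I \<and> card B = card I} = {I}"
    using assms card_subset_eq by blast
  have "bij_betw id I B" if "B \<subseteq> I" "card B = card I" for B
    using card_subset_eq[OF assms that] by simp
  from Cauchy_Binet[of I I "\<lambda>_. id", OF assms assms this, where u = A and w = B] show ?thesis
    unfolding D by simp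
qed

lemma set_det_one: "finite I \<Longrightarrow> set_det I (\<lambda>i j. of_bool (i = j)) = 1"
  using set_det_identity_rows[of I "{}" "\<lambda>i j. of_bool (i = j)"] by (simp add: set_det_def)

text \<open>
  Multiplying \<open>A\<close> by the identity matrix with column \<open>k\<close> replaced by the kernel vector \<open>g\<close> makes column
  \<open>k\<close> vanish, and the factor has determinant \<open>g k \<noteq> 0\<close>.
\<close>
lemma set_det_eq_0_if_kernel:
  fixes A :: "'a \<Rightarrow> 'a \<Rightarrow> 'b::{idom, ring_char_0}"
  assumes "finite I" "\<And>i. i \<in> I \<Longrightarrow> (\<Sum>k\<in>I. A i k * g k) = 0" "k \<in> I" "g k \<noteq> 0"
  shows "set_det I A = 0"
proof -
  let ?G = "\<lambda>i j. if j = k then g i else of_bool (i = j)"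
  have "set_det I ?G = set_det I (\<lambda>i j. ?G j i)"
    using set_det_transpose[OF assms(1), of ?G] by simp
  also have "\<dots> = set_det {k} (\<lambda>i j. ?G j i)"
    using assms by (intro set_det_identity_rows) auto
  also have "\<dots> = g k" by (simp add: set_det_def)
  finally have G: "set_det I ?G = g k" .
  have "set_det I A * set_det I ?G = set_det I (\<lambda>i j. \<Sum>l\<in>I. A i l * ?G l j)"
    by (rule set_det_mult[OF assms(1), symmetric])
  also have "\<dots> = 0"
    unfolding set_det_def
  proof (intro sum.neutral ballI)
    fix p assume "p \<in> {p. p permutes I}"
    then have p: "p permutes I" by simp
    then have i: "inv_into UNIV p k \<in> I" "p (inv_into UNIV p k) = k" using assms(3)
      by (auto simp: permutes_in_image[OF permutes_inv] permutes_inverses)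
    then have "(\<Sum>l\<in>I. A (inv_into UNIV p k) l * ?G l (p (inv_into UNIV p k))) = 0" using assms(2) by simp
    then have "(\<Prod>i\<in>I. \<Sum>l\<in>I. A i l * ?G l (p i)) = 0" using assms(1) i(1) by (meson prod_zero)
    then show "of_int (sign p) * (\<Prod>i\<in>I. \<Sum>l\<in>I. A i l * ?G l (p i)) = 0" by simp
  qed
  finally show ?thesis using G assms(4) by simp
qed

lemma det_eq_set_det:
  assumes "bij_betw b {0..<n} I"
  shows "Determinant.det (Matrix.mat n n (\<lambda>(i, j). A (b i) (b j))) = set_det I A"
proof -
  have inj: "inj_on b {0..<n}" and im: "b ` {0..<n} = I" using assms by (auto simp: bij_betw_def)
  have "Determinant.det (Matrix.mat n n (\<lambda>(i, j). A (b i) (b j)))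
      = (\<Sum>p | p permutes {0..<n}. of_int (sign p) * (\<Prod>i = 0..<n. A (b i) (b (p i))))"
    by (subst Determinant.det_def'[of _ n])
       (auto intro!: sum.cong prod.cong simp: permutes_in_image)
  also have "\<dots> = (\<Sum>p | p permutes {0..<n}. of_int (sign (map_permutation {0..<n} b p))
       * (\<Prod>i\<in>I. A i (map_permutation {0..<n} b p i)))"
  proof (intro sum.cong refl)
    fix p assume "p \<in> {p. p permutes {0..<n}}"
    then have p: "p permutes {0..<n}" by simp
    have "(\<Prod>i\<in>I. A i (map_permutation {0..<n} b p i)) = (\<Prod>i\<in>{0..<n}. A (b i) (b (p i)))"
      unfolding im[symmetric] prod.reindex[OF inj]
      by (intro prod.cong refl) (simp add: map_permutation_apply[OF inj])
    then show "of_int (sign p) * (\<Prod>i = 0..<n. A (b i) (b (p i)))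
      = of_int (sign (map_permutation {0..<n} b p)) * (\<Prod>i\<in>I. A i (map_permutation {0..<n} b p i))"
      using sign_map_permutation[OF inj p] by simp
  qed
  also have "\<dots> = set_det I A"
  proof -
    have "map_permutation {0..<n} b = (\<lambda>p x. if x \<in> I then b (p (inv_into {0..<n} b x)) else x)"
      unfolding map_permutation_def restrict_id_def im comp_def ..
    then have "bij_betw (map_permutation {0..<n} b) {p. p permutes {0..<n}} {p. p permutes I}"
      by (rule ssubst) (rule bij_betw_permutations[OF assms])
    then show ?thesis unfolding set_det_def by (rule sum.reindex_bij_betw)
  qed
  finally show ?thesis .
qed

lemma exists_left_inverse:
  fixes A :: "'a \<Rightarrow> 'a \<Rightarrow> 'b::field"
  assumes "finite I" "set_det I A \<noteq> 0"
  shows "\<exists>B. \<forall>i\<in>I. \<forall>j\<in>I. (\<Sum>k\<in>I. B i k * A k j) = of_bool (i = j)"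
proof -
  define n where "n = card I"
  obtain b where b: "bij_betw b {0..<n} I"
    using assms(1) ex_bij_betw_nat_finite n_def by blast
  define c where "c = inv_into {0..<n} b"
  have c: "c i < n" "b (c i) = i" if "i \<in> I" for i
  proof -
    have i: "i \<in> b ` {0..<n}" using that b unfolding bij_betw_def by blast
    show "c i < n" using inv_into_into[OF i] unfolding c_def by simp
    show "b (c i) = i" using f_inv_into_f[OF i] unfolding c_def .
  qed
  have cb: "c (b k) = k" if "k < n" for k using that b by (simp add: c_def bij_betw_inv_into_left)
  define Am where "Am = Matrix.mat n n (\<lambda>(i, j). A (b i) (b j))"
  have Am: "Am \<in> carrier_mat n n" by (simp add: Am_def)
  have d: "Determinant.det Am \<noteq> 0" using assms(2) det_eq_set_det[OF b, of A] by (simp add: Am_def)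
  have adj: "adj_mat Am \<in> carrier_mat n n" "adj_mat Am * Am = Determinant.det Am \<cdot>\<^sub>m 1\<^sub>m n"
    using adj_mat[OF Am] by auto
  define B where "B i k = adj_mat Am $$ (c i, c k) / Determinant.det Am" for i k
  have "(\<Sum>k\<in>I. B i k * A k j) = of_bool (i = j)" if ij: "i \<in> I" "j \<in> I" for i j
  proof -
    have "(\<Sum>k\<in>I. B i k * A k j) = (\<Sum>k\<in>{0..<n}. B i (b k) * A (b k) j)"
      by (rule sum.reindex_bij_betw[OF b, symmetric])
    also have "\<dots> = (\<Sum>k\<in>{0..<n}. adj_mat Am $$ (c i, k) * Am $$ (k, c j)) / Determinant.det Am"
      unfolding sum_divide_distrib by (intro sum.cong refl) (simp add: B_def cb Am_def c ij)
    also have "(\<Sum>k\<in>{0..<n}. adj_mat Am $$ (c i, k) * Am $$ (k, c j)) = (adj_mat Am * Am) $$ (c i, c j)"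
      using adj(1) Am c[OF ij(1)] c[OF ij(2)] by (simp add: scalar_prod_def)
    also have "\<dots> / Determinant.det Am = of_bool (i = j)"
    proof -
      have "c i = c j \<longleftrightarrow> i = j" using c(2)[OF ij(1)] c(2)[OF ij(2)] by metis
      then have "(adj_mat Am * Am) $$ (c i, c j) = Determinant.det Am * of_bool (i = j)"
        unfolding adj(2) using c(1)[OF ij(1)] c(1)[OF ij(2)] by simp
      then show ?thesis using d by simp
    qed
    finally show ?thesis .
  qed
  then show ?thesis by blast
qed

section \<open>Connected and acyclic finite graphs\<close>

abbreviation adjacent :: "'v edge set \<Rightarrow> ('v \<times> 'v) set" where
  "adjacent t \<equiv> {(x, y). {x, y} \<in> t}"

lemma adjacent_rtrancl_sym: "(u, v) \<in> (adjacent t)\<^sup>* \<Longrightarrow> (v, u) \<in> (adjacent t)\<^sup>*"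
  by (rule symD[OF sym_rtrancl]) (auto simp: sym_def insert_commute)

lemma rtrancl_simple_path:
  assumes "(u, v) \<in> r\<^sup>*"
  obtains vs where "vs \<noteq> []" "distinct vs" "hd vs = u" "last vs = v"
    "\<And>i. Suc i < length vs \<Longrightarrow> (vs ! i, vs ! Suc i) \<in> r"
proof -
  have "\<exists>vs. vs \<noteq> [] \<and> distinct vs \<and> hd vs = u \<and> last vs = v \<and>
      (\<forall>i. Suc i < length vs \<longrightarrow> (vs ! i, vs ! Suc i) \<in> r)"
    using assms
  proof (induction rule: rtrancl_induct)
    case base
    show ?case by (rule exI[of _ "[u]"]) auto
  next
    case (step y z)
    then obtain vs where vs: "vs \<noteq> []" "distinct vs" "hd vs = u" "last vs = y"
      "\<And>i. Suc i < length vs \<Longrightarrow> (vs ! i, vs ! Suc i) \<in> r" by blast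
    show ?case
    proof (cases "z \<in> set vs")
      case True
      then obtain k where k: "k < length vs" "vs ! k = z" by (auto simp: in_set_conv_nth)
      have "distinct (take (Suc k) vs)" using vs(2) by (rule distinct_take)
      moreover have "take (Suc k) vs \<noteq> []" "hd (take (Suc k) vs) = u" using vs by auto
      moreover have "last (take (Suc k) vs) = z" using k by (simp add: take_Suc_conv_app_nth)
      moreover have "\<forall>i. Suc i < length (take (Suc k) vs) \<longrightarrow>
          (take (Suc k) vs ! i, take (Suc k) vs ! Suc i) \<in> r"
        using vs(5) by simp
      ultimately show ?thesis by blast
    next
      case False
      have "((vs @ [z]) ! i, (vs @ [z]) ! Suc i) \<in> r" if "Suc i < length (vs @ [z])" for i
      proof (cases "Suc i < length vs")
        case True then show ?thesis using vs(5)[of i] by (simp add: nth_append)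
      next
        case False
        then have "i = length vs - 1" "Suc i = length vs" using that by auto
        then show ?thesis using vs(1,4) step.hyps(2) by (simp add: nth_append last_conv_nth)
      qed
      then show ?thesis using vs False by (intro exI[of _ "vs @ [z]"]) auto
    qed
  qed
  then show ?thesis using that by blast
qed

text \<open>A simple path joining the ends of the edge and avoiding it would close up to a cycle.\<close>
lemma acyclic_edge_is_bridge:
  assumes "acyclic_graph (V, t)" "{u, v} \<in> t" "u \<noteq> v"
  shows "(u, v) \<notin> (adjacent (t - {{u, v}}))\<^sup>*"
proof
  assume "(u, v) \<in> (adjacent (t - {{u, v}}))\<^sup>*"
  then obtain vs where vs: "vs \<noteq> []" "distinct vs" "hd vs = u" "last vs = v"
    "\<And>i. Suc i < length vs \<Longrightarrow> (vs ! i, vs ! Suc i) \<in> adjacent (t - {{u, v}})"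
    by (rule rtrancl_simple_path) blast
  have ends: "vs ! 0 = u" "vs ! (length vs - 1) = v"
    using vs by (auto simp: hd_conv_nth last_conv_nth)
  have "length vs \<noteq> 1" using ends assms(3) by auto
  moreover have "length vs \<noteq> 2" using vs(5)[of 0] ends by auto
  moreover have "length vs \<noteq> 0" using vs(1) by simp
  ultimately have len: "3 \<le> length vs" by linarith
  have "{vs ! i, vs ! (Suc i mod length vs)} \<in> t" if "i < length vs" for i
  proof (cases "Suc i < length vs")
    case True then show ?thesis using vs(5)[of i] by simp
  next
    case False
    then have "i = length vs - 1" "Suc i = length vs" using that by auto
    then show ?thesis using ends assms(2) by (simp add: insert_commute)
  qed
  then show False using assms(1) len vs(2) by (auto simp: acyclic_graph_def)
qed

text \<open>The rest of the cycle is a detour around the removed edge.\<close>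
lemma cycle_edge_removable:
  assumes "connected_graph (V, t)" "\<not> acyclic_graph (V, t)"
  obtains e where "e \<in> t" "connected_graph (V, t - {e})"
proof -
  obtain vs where vs: "3 \<le> length vs" "distinct vs"
    "\<And>i. i < length vs \<Longrightarrow> {vs ! i, vs ! (Suc i mod length vs)} \<in> t"
    using assms(2) by (auto simp: acyclic_graph_def)
  define k where "k = length vs - 1"
  have k: "Suc k = length vs" "2 \<le> k" using vs(1) by (auto simp: k_def)
  define e where "e = {vs ! k, vs ! 0}"
  have e: "e \<in> t" using vs(3)[of k] k by (simp add: e_def)
  have "(vs ! 0, vs ! i) \<in> (adjacent (t - {e}))\<^sup>*" if "i \<le> k" for i
    using that
  proof (induction i)
    case (Suc i)
    have "vs ! i = vs ! l \<longleftrightarrow> i = l" "vs ! Suc i = vs ! l \<longleftrightarrow> Suc i = l" if "l \<le> k" for l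
      using nth_eq_iff_index_eq[OF vs(2)] k Suc.prems that by auto
    then have "{vs ! i, vs ! Suc i} \<noteq> e"
      using k Suc.prems by (auto simp: e_def doubleton_eq_iff)
    moreover have "{vs ! i, vs ! Suc i} \<in> t" using vs(3)[of i] k Suc.prems by simp
    ultimately have "(vs ! i, vs ! Suc i) \<in> adjacent (t - {e})" by simp
    then show ?case using Suc by (auto intro: rtrancl_into_rtrancl)
  qed simp
  then have bypass: "(vs ! 0, vs ! k) \<in> (adjacent (t - {e}))\<^sup>*" by simp
  have "adjacent t \<subseteq> (adjacent (t - {e}))\<^sup>*"
  proof
    fix p assume p: "p \<in> adjacent t"
    obtain x y where xy: "p = (x, y)" by (cases p)
    show "p \<in> (adjacent (t - {e}))\<^sup>*"
    proof (cases "{x, y} = e")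
      case True
      then show ?thesis using bypass adjacent_rtrancl_sym[OF bypass] xy
        by (auto simp: e_def doubleton_eq_iff)
    next
      case False then show ?thesis using p xy by auto
    qed
  qed
  then have "(adjacent t)\<^sup>* \<subseteq> (adjacent (t - {e}))\<^sup>*" by (rule rtrancl_subset_rtrancl)
  then have "connected_graph (V, t - {e})"
    using assms(1) by (auto simp: connected_graph_def)
  then show ?thesis using that e by blast
qed

text \<open>
  Grow a connected vertex set \<open>C\<close> from a root: as long as \<open>C \<noteq> V\<close>, some edge leaves \<open>C\<close>, and adding it
  increases the numbers of vertices and of edges by one.
\<close>
lemma connected_spanning_subset:
  assumes "finite V" "V \<noteq> {}" "connected_graph (V, t)" "\<And>e. e \<in> t \<Longrightarrow> e \<subseteq> V"
  obtains t' where "t' \<subseteq> t" "finite t'" "card t' = card V - 1" "connected_graph (V, t')"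
proof -
  obtain r where r: "r \<in> V" using assms(2) by blast
  have "\<exists>C t'. r \<in> C \<and> C \<subseteq> V \<and> card C = Suc k \<and> t' \<subseteq> t \<and> finite t' \<and> card t' = k \<and>
      (\<forall>e\<in>t'. e \<subseteq> C) \<and> (\<forall>u\<in>C. (r, u) \<in> (adjacent t')\<^sup>*)" if "Suc k \<le> card V" for k
    using that
  proof (induction k)
    case 0
    show ?case using r by (intro exI[of _ "{r}"] exI[of _ "{}"]) auto
  next
    case (Suc k)
    then obtain C t' where IH: "r \<in> C" "C \<subseteq> V" "card C = Suc k" "t' \<subseteq> t" "finite t'" "card t' = k"
      "\<And>e. e \<in> t' \<Longrightarrow> e \<subseteq> C" "\<And>u. u \<in> C \<Longrightarrow> (r, u) \<in> (adjacent t')\<^sup>*"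
      by auto
    then obtain v where v: "v \<in> V" "v \<notin> C"
      using Suc.prems by (metis Suc_n_not_le_n subsetI subset_antisym)
    have "(r, v) \<in> (adjacent t)\<^sup>*" using assms(3) r v by (simp add: connected_graph_def)
    then have "v \<notin> C \<longrightarrow> (\<exists>x y. x \<in> C \<and> y \<notin> C \<and> {x, y} \<in> t)"
    proof (induction rule: rtrancl_induct)
      case base show ?case using IH(1) by simp
    next
      case (step y z) then show ?case by blast
    qed
    then obtain x y where xy: "x \<in> C" "y \<notin> C" "{x, y} \<in> t" using v by blast
    have yV: "y \<in> V" using assms(4)[OF xy(3)] by simp
    have new: "{x, y} \<notin> t'" using IH(7) xy(2) by blast
    have fC: "finite C" using IH(2) assms(1) finite_subset by blast
    have mono: "(adjacent t')\<^sup>* \<subseteq> (adjacent (insert {x, y} t'))\<^sup>*" by (rule rtrancl_mono) auto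
    have "(r, y) \<in> (adjacent (insert {x, y} t'))\<^sup>*"
      by (rule rtrancl_into_rtrancl[of r x]) (use mono IH(8)[OF xy(1)] in auto)
    then have "\<forall>u\<in>insert y C. (r, u) \<in> (adjacent (insert {x, y} t'))\<^sup>*"
      using mono IH(8) by blast
    then show ?case using IH xy yV new fC
      by (intro exI[of _ "insert y C"] exI[of _ "insert {x, y} t'"]) auto
  qed
  moreover have cV: "Suc (card V - 1) = card V" using assms(1,2) by (simp add: card_gt_0_iff)
  ultimately obtain C t' where *: "C \<subseteq> V" "card C = card V" "t' \<subseteq> t" "finite t'" "card t' = card V - 1"
      "\<And>u. u \<in> C \<Longrightarrow> (r, u) \<in> (adjacent t')\<^sup>*"
    by (metis order_refl)
  then have "C = V" using assms(1) card_subset_eq by blast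
  then have "connected_graph (V, t')"
    using *(6) by (auto simp: connected_graph_def intro: rtrancl_trans adjacent_rtrancl_sym)
  then show ?thesis using that * by blast
qed

lemma connected_acyclic_iff_card:
  assumes "finite V" "V \<noteq> {}" "\<And>e. e \<in> t \<Longrightarrow> e \<subseteq> V \<and> card e = 2" "connected_graph (V, t)"
  shows "acyclic_graph (V, t) \<longleftrightarrow> card t = card V - 1"
proof
  have "t \<subseteq> Pow V" using assms(3) by blast
  then have ft: "finite t" using assms(1) finite_subset by blast
  {
    assume ac: "acyclic_graph (V, t)"
    obtain t' where t': "t' \<subseteq> t" "finite t'" "card t' = card V - 1" "connected_graph (V, t')"
      by (rule connected_spanning_subset[OF assms(1,2,4)]) (use assms(3) in blast)
    have "e \<in> t'" if et: "e \<in> t" for e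
    proof (rule ccontr)
      assume "e \<notin> t'"
      obtain u v where uv: "e = {u, v}" "u \<noteq> v" using assms(3)[OF et] card_2_iff[of e] by blast
      then have "u \<in> V" "v \<in> V" using assms(3)[OF et] by auto
      then have "(u, v) \<in> (adjacent t')\<^sup>*" using t'(4) by (simp add: connected_graph_def)
      moreover have "(adjacent t')\<^sup>* \<subseteq> (adjacent (t - {e}))\<^sup>*"
        using t'(1) \<open>e \<notin> t'\<close> by (intro rtrancl_mono) auto
      ultimately show False using acyclic_edge_is_bridge[OF ac] et uv by blast
    qed
    then have "t = t'" using t'(1) by blast
    then show "card t = card V - 1" using t'(3) by simp
  }
  {
    assume c: "card t = card V - 1"
    show "acyclic_graph (V, t)"
    proof (rule ccontr)
      assume cyclic: "\<not> acyclic_graph (V, t)"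
      obtain e where e: "e \<in> t" "connected_graph (V, t - {e})"
        by (rule cycle_edge_removable[OF assms(4) cyclic])
      have "d \<subseteq> V" if "d \<in> t - {e}" for d using assms(3) that by blast
      then obtain t' where t': "t' \<subseteq> t - {e}" "card t' = card V - 1"
        by (rule connected_spanning_subset[OF assms(1,2) e(2)])
      have "card t' \<le> card (t - {e})" using t'(1) ft by (intro card_mono) auto
      also have "\<dots> < card t" by (rule card_Diff1_less[OF ft e(1)])
      finally show False unfolding c t'(2) by simp
    qed
  }
qed

section \<open>A matrix-tree theorem on integer intervals\<close>

text \<open>
  The index \<open>j\<close> stands for the gap between \<open>j - 1\<close> and \<open>j\<close>. As a function of \<open>j\<close>, \<open>crosses e\<close> is the
  coordinate vector of \<open>e\<close> with respect to the path of all edges \<open>z_edge j\<close>.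
\<close>
definition crosses :: "int edge \<Rightarrow> int \<Rightarrow> bool" where
  "crosses e j \<longleftrightarrow> (\<exists>p\<in>e. \<exists>q\<in>e. p < j \<and> j \<le> q)"

lemma crosses_doubleton: "crosses {p, q} j \<longleftrightarrow> p < j \<and> j \<le> q \<or> q < j \<and> j \<le> p"
  by (simp add: crosses_def) linarith

lemma sum_differences_int:
  fixes g :: "int \<Rightarrow> 'b::ab_group_add"
  assumes "p \<le> q"
  shows "(\<Sum>i\<in>{p+1..q}. g i - g (i - 1)) = g q - g p"
  using assms
proof (induction q rule: int_ge_induct)
  case (step q)
  have "{p+1..q+1} = insert (q+1) {p+1..q}" using step.hyps by auto
  then show ?case using step by simp
qed simp

text \<open>
  A walk in \<open>t\<close> from \<open>j - 1\<close> to \<open>j\<close> writes the \<open>j\<close>-th unit vector as an integral combination of the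
  vectors of the edges of \<open>t\<close>. So the matrix has an integral inverse, and its determinant is a unit.
\<close>
lemma det_crosses_connected:
  assumes "connected_graph ({a..b}, t)" "bij_betw \<beta> {a+1..b} t"
  shows "(set_det {a+1..b} (\<lambda>i j. of_bool (crosses (\<beta> i) j)) :: int)\<^sup>2 = 1"
proof -
  let ?I = "{a+1..b}"
  have "finite t" using assms(2) bij_betw_finite by blast
  \<comment> \<open>An edge from \<open>v\<close> to \<open>w\<close> counts with the sign of \<open>w - v\<close>, so that the sum telescopes along a walk.\<close>
  have path: "\<exists>c::int edge \<Rightarrow> int. \<forall>i. (\<Sum>e\<in>t. c e * of_bool (crosses e i)) = of_bool (i \<le> v) - of_bool (i \<le> u)"
    if "(u, v) \<in> (adjacent t)\<^sup>*" for u v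
    using that
  proof (induction rule: rtrancl_induct)
    case base
    show ?case by (intro exI[of _ "\<lambda>_. 0"]) simp
  next
    case (step v w)
    then obtain c :: "int edge \<Rightarrow> int"
      where c: "\<And>i. (\<Sum>e\<in>t. c e * of_bool (crosses e i)) = of_bool (i \<le> v) - of_bool (i \<le> u)" by blast
    have vw: "{v, w} \<in> t" using step.hyps(2) by simp
    show ?case
    proof (intro exI allI)
      fix i
      have "(\<Sum>e\<in>t. (c e + of_bool (e = {v, w}) * sgn (w - v)) * of_bool (crosses e i))
          = (\<Sum>e\<in>t. c e * of_bool (crosses e i)) + (\<Sum>e\<in>t. if e = {v, w} then sgn (w - v) * of_bool (crosses e i) else 0)"
        unfolding sum.distrib[symmetric] by (intro sum.cong refl) (auto simp: algebra_simps)
      also have "(\<Sum>e\<in>t. if e = {v, w} then sgn (w - v) * of_bool (crosses e i) else 0)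
          = sgn (w - v) * of_bool (crosses {v, w} i)"
        using \<open>finite t\<close> vw by simp
      also have "\<dots> = of_bool (i \<le> w) - of_bool (i \<le> v)"
        by (auto simp: crosses_doubleton sgn_if)
      finally show "(\<Sum>e\<in>t. (c e + of_bool (e = {v, w}) * sgn (w - v)) * of_bool (crosses e i))
          = of_bool (i \<le> w) - of_bool (i \<le> u)" using c by simp
    qed
  qed
  have "\<exists>c::int edge \<Rightarrow> int. \<forall>i. (\<Sum>e\<in>t. c e * of_bool (crosses e i)) = of_bool (j = i)" if "j \<in> ?I" for j
  proof -
    have "(j - 1, j) \<in> (adjacent t)\<^sup>*" using assms(1) that by (auto simp: connected_graph_def)
    then obtain c :: "int edge \<Rightarrow> int"
      where c: "\<And>i. (\<Sum>e\<in>t. c e * of_bool (crosses e i)) = of_bool (i \<le> j) - of_bool (i \<le> j - 1)"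
      using path by blast
    have "(\<Sum>e\<in>t. c e * of_bool (crosses e i)) = of_bool (j = i)" for i
      unfolding c by auto
    then show ?thesis by blast
  qed
  then obtain c :: "int \<Rightarrow> int edge \<Rightarrow> int" where
    c: "\<And>j i. j \<in> ?I \<Longrightarrow> (\<Sum>e\<in>t. c j e * of_bool (crosses e i)) = of_bool (j = i)" by metis
  let ?D = "set_det ?I (\<lambda>i j. of_bool (crosses (\<beta> i) j)) :: int"
  have "set_det ?I (\<lambda>j k. c j (\<beta> k)) * ?D = set_det ?I (\<lambda>j i. \<Sum>k\<in>?I. c j (\<beta> k) * of_bool (crosses (\<beta> k) i))"
    by (rule set_det_mult[symmetric]) simp
  also have "\<dots> = set_det ?I (\<lambda>j i. of_bool (j = i))"
  proof (rule set_det_cong)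
    fix j i assume j: "j \<in> ?I"
    show "(\<Sum>k\<in>?I. c j (\<beta> k) * of_bool (crosses (\<beta> k) i)) = of_bool (j = i)"
      using sum.reindex_bij_betw[OF assms(2), of "\<lambda>e. c j e * of_bool (crosses e i)"] c[OF j] by simp
  qed
  also have "\<dots> = 1" by (simp add: set_det_one)
  finally have "?D dvd 1" by (metis dvd_triv_right)
  then have "\<bar>?D\<bar> = 1" by simp
  then show ?thesis by (metis one_power2 power2_abs)
qed

text \<open>
  The differences of the indicator of a connected component form a nonzero vector in the kernel:
  along an edge of \<open>t\<close> they sum to the difference of the indicator at its ends, which is zero.
\<close>
lemma det_crosses_disconnected:
  assumes "\<not> connected_graph ({a..b}, t)" "\<And>i. i \<in> {a+1..b} \<Longrightarrow> \<beta> i \<in> t"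
    and "\<And>e. e \<in> t \<Longrightarrow> e \<subseteq> {a..b} \<and> card e = 2"
  shows "(set_det {a+1..b} (\<lambda>i j. of_bool (crosses (\<beta> i) j)) :: int) = 0"
proof -
  obtain u v where uv: "u \<in> {a..b}" "v \<in> {a..b}" "(u, v) \<notin> (adjacent t)\<^sup>*"
    using assms(1) by (auto simp: connected_graph_def)
  define \<phi> :: "int \<Rightarrow> int" where "\<phi> x = of_bool ((u, x) \<in> (adjacent t)\<^sup>*)" for x
  have "\<exists>k\<in>{a+1..b}. \<phi> k - \<phi> (k - 1) \<noteq> 0"
  proof (rule ccontr)
    assume "\<not> ?thesis"
    then have const: "\<phi> k - \<phi> (k - 1) = 0" if "k \<in> {a+1..b}" for k using that by blast
    have "\<phi> x = \<phi> a" if "x \<in> {a..b}" for x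
    proof -
      have "(\<Sum>i\<in>{a+1..x}. \<phi> i - \<phi> (i - 1)) = 0"
        by (rule sum.neutral) (use const that in auto)
      then show ?thesis using sum_differences_int[of a x \<phi>] that by simp
    qed
    from this[OF uv(1)] this[OF uv(2)] uv(3) show False by (simp add: \<phi>_def)
  qed
  then obtain k where k: "k \<in> {a+1..b}" "\<phi> k - \<phi> (k - 1) \<noteq> 0" by blast
  show ?thesis
  proof (rule set_det_eq_0_if_kernel[where g = "\<lambda>i. \<phi> i - \<phi> (i - 1)", OF _ _ k])
    fix i assume i: "i \<in> {a+1..b}"
    have *: "\<beta> i \<in> t" using assms(2) i by blast
    then obtain p q where pq: "\<beta> i = {p, q}" "p < q"
      using assms(3) card_2_iff by (metis insert_commute linorder_neqE)
    have ab: "a \<le> p" "q \<le> b" using assms(3)[OF *] pq by auto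
    have "(\<Sum>k\<in>{a+1..b}. of_bool (crosses (\<beta> i) k) * (\<phi> k - \<phi> (k - 1)))
        = (\<Sum>k\<in>{p+1..q}. of_bool (crosses (\<beta> i) k) * (\<phi> k - \<phi> (k - 1)))"
      using pq ab by (intro sum.mono_neutral_right) (auto simp: crosses_doubleton)
    also have "\<dots> = (\<Sum>k\<in>{p+1..q}. \<phi> k - \<phi> (k - 1))"
      using pq by (intro sum.cong) (auto simp: crosses_doubleton)
    also have "\<dots> = \<phi> q - \<phi> p" using pq by (intro sum_differences_int) simp
    also have "\<dots> = 0"
    proof -
      have pqa: "(p, q) \<in> adjacent t" "(q, p) \<in> adjacent t"
        using * pq by (auto simp: insert_commute)
      then have "(u, p) \<in> (adjacent t)\<^sup>* \<longleftrightarrow> (u, q) \<in> (adjacent t)\<^sup>*"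
        by (meson rtrancl_into_rtrancl)
      then show ?thesis by (simp add: \<phi>_def)
    qed
    finally show "(\<Sum>k\<in>{a+1..b}. of_bool (crosses (\<beta> i) k) * (\<phi> k - \<phi> (k - 1))) = 0" .
  qed simp
qed

text \<open>
  In the Cauchy-Binet formula for the Gram matrix of the vectors \<open>crosses e\<close>, the sets \<open>t\<close> that occur
  have the size of a spanning tree, and each contributes a square that is \<open>1\<close> or \<open>0\<close> according to
  whether \<open>t\<close> is connected.
\<close>
theorem matrix_tree_interval:
  assumes "a \<le> b" "finite E" "\<And>e. e \<in> E \<Longrightarrow> e \<subseteq> {a..b} \<and> card e = 2"
  shows "int (card (spanning_trees ({a..b}, E)))
    = set_det {a+1..b} (\<lambda>i j. \<Sum>e\<in>E. of_bool (crosses e i) * of_bool (crosses e j))"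
proof -
  let ?I = "{a+1..b}"
  let ?D = "{t. t \<subseteq> E \<and> card t = card ?I}"
  have "\<exists>\<beta>. bij_betw \<beta> ?I t" if "t \<subseteq> E" "card t = card ?I" for t
    using that finite_subset[OF that(1) assms(2)] by (intro finite_same_card_bij) auto
  then obtain \<beta> where \<beta>: "\<And>t. t \<subseteq> E \<Longrightarrow> card t = card ?I \<Longrightarrow> bij_betw (\<beta> t) ?I t" by metis
  have "set_det ?I (\<lambda>i j. \<Sum>e\<in>E. of_bool (crosses e i) * of_bool (crosses e j))
     = (\<Sum>t\<in>?D. set_det ?I (\<lambda>i j. of_bool (crosses (\<beta> t j) i)) * set_det ?I (\<lambda>i j. of_bool (crosses (\<beta> t i) j)) :: int)"
    by (rule Cauchy_Binet[OF _ assms(2) \<beta>]) auto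
  also have "\<dots> = (\<Sum>t\<in>?D. of_bool (connected_graph ({a..b}, t)))"
  proof (intro sum.cong refl)
    fix t assume t: "t \<in> ?D"
    let ?d = "set_det ?I (\<lambda>i j. of_bool (crosses (\<beta> t i) j)) :: int"
    have "set_det ?I (\<lambda>i j. of_bool (crosses (\<beta> t j) i)) * ?d = ?d\<^sup>2"
      using set_det_transpose[of ?I "\<lambda>i j. of_bool (crosses (\<beta> t i) j) :: int"] by (simp add: power2_eq_square)
    also have "\<dots> = of_bool (connected_graph ({a..b}, t))"
    proof (cases "connected_graph ({a..b}, t)")
      case True
      then show ?thesis using det_crosses_connected[OF True, of "\<beta> t"] \<beta>[of t] t by simp
    next
      case False
      have "\<beta> t i \<in> t" if "i \<in> ?I" for i using \<beta>[of t] t that by (auto simp: bij_betw_def)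
      moreover have "e \<subseteq> {a..b} \<and> card e = 2" if "e \<in> t" for e using assms(3) t that by blast
      ultimately show ?thesis using det_crosses_disconnected[OF False, of "\<beta> t"] False by simp
    qed
    finally show "set_det ?I (\<lambda>i j. of_bool (crosses (\<beta> t j) i)) * ?d = of_bool (connected_graph ({a..b}, t))" .
  qed
  also have "\<dots> = int (card {t\<in>?D. connected_graph ({a..b}, t)})"
    using assms(2) by (simp add: sum.If_cases of_bool_def Int_def)
  also have "{t\<in>?D. connected_graph ({a..b}, t)} = spanning_trees ({a..b}, E)"
  proof -
    have "card ?I = card {a..b} - 1" using assms(1) by (simp add: nat_diff_distrib' nat_add_distrib)
    moreover have "acyclic_graph ({a..b}, t) \<longleftrightarrow> card t = card {a..b} - 1"
      if "t \<subseteq> E" "connected_graph ({a..b}, t)" for t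
    proof (rule connected_acyclic_iff_card)
      show "e \<subseteq> {a..b} \<and> card e = 2" if "e \<in> t" for e using assms(3) \<open>t \<subseteq> E\<close> that by blast
    qed (use assms(1) that in auto)
    ultimately show ?thesis unfolding spanning_trees_def fst_conv snd_conv by auto
  qed
  finally show ?thesis by (rule sym)
qed

lemma crosses_z_edge: "crosses (z_edge s) j \<longleftrightarrow> j = s"
  by (auto simp: z_edge_def crosses_doubleton)

lemma inj_z_edge: "inj z_edge"
  by (auto simp: inj_def z_edge_def doubleton_eq_iff)

text \<open>
  Induction on \<open>S\<close> by deletion: the trees through \<open>z_edge s\<close> are all trees except those of the graph
  without it. The two determinants differ only in row \<open>s\<close>, by a unit vector, because \<open>z_edge s\<close>
  crosses only the gap \<open>s\<close>.
\<close>
theorem matrix_tree_forced_edges: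
  assumes "a \<le> b" "finite S" "S \<subseteq> {a+1..b}" "finite E" "z_edge ` S \<subseteq> E"
    and "\<And>e. e \<in> E \<Longrightarrow> e \<subseteq> {a..b} \<and> card e = 2"
  shows "int (card {t\<in>spanning_trees ({a..b}, E). z_edge ` S \<subseteq> t})
    = set_det {a+1..b} (\<lambda>i j. if i \<in> S then of_bool (i = j)
        else \<Sum>e\<in>E. of_bool (crosses e i) * of_bool (crosses e j))"
  using assms(2-6)
proof (induction S arbitrary: E rule: finite_induct)
  case empty
  then show ?case using matrix_tree_interval[OF assms(1), of E] by simp
next
  case (insert s S)
  let ?I = "{a+1..b}"
  let ?T = "\<lambda>E. {t\<in>spanning_trees ({a..b}, E). z_edge ` S \<subseteq> t}"
  let ?A = "\<lambda>E i j. if i \<in> S then of_bool (i = j)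
        else \<Sum>e\<in>E. of_bool (crosses e i) * of_bool (crosses e j) :: int"
  have zs: "z_edge s \<in> E" "z_edge s \<notin> z_edge ` S"
    using insert inj_z_edge by (auto simp: inj_image_mem_iff)
  have M_remove: "(\<Sum>e\<in>E. of_bool (crosses e i) * of_bool (crosses e j))
      = of_bool (i = s \<and> j = s) + (\<Sum>e\<in>E - {z_edge s}. of_bool (crosses e i) * of_bool (crosses e j) :: int)" for i j
    unfolding sum.remove[OF insert.prems(2) zs(1)] crosses_z_edge by (simp only: of_bool_conj)
  have finE: "finite (?T E)"
    using insert.prems(2) by (auto intro!: finite_subset[of _ "Pow E"] simp: spanning_trees_def)
  have sub: "?T (E - {z_edge s}) \<subseteq> ?T E" by (auto simp: spanning_trees_def)
  have "{t\<in>spanning_trees ({a..b}, E). z_edge ` insert s S \<subseteq> t} = ?T E - ?T (E - {z_edge s})"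
    by (auto simp: spanning_trees_def)
  then have "int (card {t\<in>spanning_trees ({a..b}, E). z_edge ` insert s S \<subseteq> t})
      = int (card (?T E)) - int (card (?T (E - {z_edge s})))"
    using finE sub by (simp add: card_Diff_subset finite_subset card_mono of_nat_diff)
  also have "\<dots> = set_det ?I (?A E) - set_det ?I (?A (E - {z_edge s}))"
    using insert.IH[of E] insert.IH[of "E - {z_edge s}"] insert.prems zs by (simp add: subset_Diff_insert)
  also have "\<dots> = set_det ?I (\<lambda>i j. if i \<in> insert s S then of_bool (i = j)
        else \<Sum>e\<in>E. of_bool (crosses e i) * of_bool (crosses e j))"
  proof (rule set_det_row_diff[symmetric, of _ s])
    fix j
    show "(if s \<in> insert s S then of_bool (s = j)
        else \<Sum>e\<in>E. of_bool (crosses e s) * of_bool (crosses e j)) = ?A E s j - ?A (E - {z_edge s}) s j"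
      using insert.hyps(2) unfolding M_remove[of s j] by auto
  next
    fix i assume "i \<in> ?I" "i \<noteq> s"
    then show "?A E i = (\<lambda>j. if i \<in> insert s S then of_bool (i = j)
        else \<Sum>e\<in>E. of_bool (crosses e i) * of_bool (crosses e j))
      \<and> ?A (E - {z_edge s}) i = (\<lambda>j. if i \<in> insert s S then of_bool (i = j)
        else \<Sum>e\<in>E. of_bool (crosses e i) * of_bool (crosses e j))"
      unfolding M_remove[of i] by (simp add: fun_eq_iff del: sum_of_bool_mult_eq of_bool_conj)
  qed (use insert.prems in auto)
  finally show ?case .
qed

section \<open>Spanning trees of the finite helix graphs\<close>

lemma crosses_h_edge: "crosses (h_edge m) j \<longleftrightarrow> m - 2 \<le> j \<and> j \<le> m"
  unfolding h_edge_def crosses_doubleton by linarith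

lemma inj_h_edge: "inj h_edge"
  by (auto simp: inj_def h_edge_def doubleton_eq_iff)

lemma helix3_sub_eq:
  "helix3_sub a b = ({a..b}, z_edge ` {a+1..b} \<union> h_edge ` {a+3..b})"
  by (auto simp: helix3_sub_def induced_subgraph_def helix3_def z_edge_def h_edge_def)

abbreviation helix3_edges :: "int \<Rightarrow> int \<Rightarrow> int edge set" where
  "helix3_edges a b \<equiv> z_edge ` {a+1..b} \<union> h_edge ` {a+3..b}"

text \<open>
  Over an arbitrary ring, since trees are counted by integers while the limit is taken in the reals.
\<close>
definition gram :: "int edge set \<Rightarrow> int \<Rightarrow> int \<Rightarrow> 'b::comm_ring_1" where
  "gram E i j = (\<Sum>e\<in>E. of_bool (crosses e i) * of_bool (crosses e j))"

lemma of_int_gram: "of_int (gram E i j) = gram E i j"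
  by (simp only: gram_def of_int_sum of_int_mult of_int_of_bool)

lemma of_int_set_det: "of_int (set_det I A) = set_det I (\<lambda>i j. of_int (A i j))"
  by (simp add: set_det_def)

lemma helix3_edges_subset:
  "e \<in> helix3_edges a b \<Longrightarrow> e \<subseteq> {a..b} \<and> card e = 2"
  by (auto simp: z_edge_def h_edge_def)

lemma finite_spanning_trees: "finite E \<Longrightarrow> finite (spanning_trees (V, E))"
  by (auto intro!: finite_subset[of _ "Pow E"] simp: spanning_trees_def)

lemma card_forced_helix3:
  assumes "a \<le> b" "S \<subseteq> {a+1..b}"
  shows "real (card {t\<in>spanning_trees (helix3_sub a b). z_edge ` S \<subseteq> t})
    = set_det {a+1..b} (\<lambda>i j. if i \<in> S then of_bool (i = j) else gram (helix3_edges a b) i j)"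
proof -
  have "int (card {t\<in>spanning_trees ({a..b}, helix3_edges a b). z_edge ` S \<subseteq> t})
    = set_det {a+1..b} (\<lambda>i j. if i \<in> S then of_bool (i = j) else gram (helix3_edges a b) i j)"
    unfolding gram_def
    using assms finite_subset[OF assms(2)]
    by (intro matrix_tree_forced_edges helix3_edges_subset) auto
  then have "real_of_int (int (card {t\<in>spanning_trees (helix3_sub a b). z_edge ` S \<subseteq> t}))
    = set_det {a+1..b} (\<lambda>i j. real_of_int (if i \<in> S then of_bool (i = j) else gram (helix3_edges a b) i j))"
    by (simp only: helix3_sub_eq of_int_set_det)
  also have "\<dots> = set_det {a+1..b} (\<lambda>i j. if i \<in> S then of_bool (i = j) else gram (helix3_edges a b) i j)"
    by (rule set_det_cong) (simp add: of_int_gram)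
  finally show ?thesis by (simp only: of_int_of_nat_eq)
qed

text \<open>If all edges \<open>z_edge j\<close> are forced, the determinant is that of the identity matrix.\<close>
lemma spanning_trees_helix3_nonempty:
  assumes "a \<le> b"
  shows "spanning_trees (helix3_sub a b) \<noteq> {}"
proof
  assume "spanning_trees (helix3_sub a b) = {}"
  then have "(0::real) = set_det {a+1..b} (\<lambda>i j. if i \<in> {a+1..b} then of_bool (i = j) else gram (helix3_edges a b) i j)"
    using card_forced_helix3[OF assms order_refl] by simp
  also have "\<dots> = set_det {a+1..b} (\<lambda>i j. of_bool (i = j))" by (rule set_det_cong) simp
  also have "\<dots> = 1" by (rule set_det_one) simp
  finally show False by simp
qed

text \<open>
  The matrix counting the trees through \<open>z_edge ` S\<close> is \<open>P * M\<close>, where \<open>M\<close> is the Gram matrix and \<open>P\<close> has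
  the rows of \<open>B\<close>, the inverse of \<open>M\<close>, at the indices in \<open>S\<close> and unit rows elsewhere. Hence the quotient
  of the two counts is the determinant of \<open>P\<close>, which is a principal minor of \<open>B\<close>.
\<close>
lemma prob_forced_edges:
  assumes "a \<le> b" "S \<subseteq> {a+1..b}"
    and B: "\<And>i j. i \<in> {a+1..b} \<Longrightarrow> j \<in> {a+1..b} \<Longrightarrow>
        (\<Sum>k\<in>{a+1..b}. B i k * gram (helix3_edges a b) k j) = of_bool (i = j)"
  shows "measure_pmf.prob (pmf_of_set (spanning_trees (helix3_sub a b))) {t. z_edge ` S \<subseteq> t} = set_det S B"
proof -
  let ?I = "{a+1..b}" and ?E = "helix3_edges a b"
  let ?T = "spanning_trees (helix3_sub a b)"
  let ?P = "\<lambda>i j. if i \<in> S then B i j else of_bool (i = j)"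
  have fin: "finite ?T" unfolding helix3_sub_eq by (rule finite_spanning_trees) simp
  have "measure_pmf.prob (pmf_of_set ?T) {t. z_edge ` S \<subseteq> t}
      = real (card {t\<in>?T. z_edge ` S \<subseteq> t}) / real (card ?T)"
    using fin spanning_trees_helix3_nonempty[OF assms(1)]
    by (simp add: measure_pmf_of_set Int_def)
  also have "real (card ?T) = set_det ?I (gram ?E)"
    using card_forced_helix3[OF assms(1), of "{}"] by simp
  also have "real (card {t\<in>?T. z_edge ` S \<subseteq> t}) = set_det ?I ?P * set_det ?I (gram ?E)"
    unfolding card_forced_helix3[OF assms(1,2)]
  proof (subst set_det_mult[symmetric], simp, rule set_det_cong)
    fix i j assume ij: "i \<in> ?I" "j \<in> ?I"
    show "(if i \<in> S then of_bool (i = j) else gram ?E i j) = (\<Sum>k\<in>?I. ?P i k * gram ?E k j)"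
    proof (cases "i \<in> S")
      case True then show ?thesis using B[OF ij] by simp
    next
      case False
      have "(\<Sum>k\<in>?I. ?P i k * gram ?E k j) = (\<Sum>k\<in>?I. if k = i then gram ?E k j else 0)"
        using False by (intro sum.cong) auto
      then show ?thesis using False ij(1) by simp
    qed
  qed
  also have "set_det ?I ?P = set_det S ?P"
    using assms(2) by (intro set_det_identity_rows) auto
  also have "set_det S ?P = set_det S B" by (rule set_det_cong) simp
  also have "set_det S B * set_det ?I (gram ?E) / set_det ?I (gram ?E) = set_det S B"
  proof -
    have "card ?T \<noteq> 0" using fin spanning_trees_helix3_nonempty[OF assms(1)] by simp
    then have "set_det ?I (gram ?E) \<noteq> (0::real)"
      using card_forced_helix3[OF assms(1), of "{}"] by simp
    then show ?thesis by simp
  qed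
  finally show ?thesis .
qed

section \<open>Convergence of the inverse Gram matrices\<close>

lemma gram_row_sum:
  "(\<Sum>i\<in>I. x i * gram E i j) = (\<Sum>e\<in>E. (\<Sum>i\<in>I. x i * of_bool (crosses e i)) * of_bool (crosses e j))"
  unfolding gram_def sum_distrib_left sum_distrib_right
  by (subst sum.swap) (simp only: mult.assoc)

text \<open>
  The path edges alone contribute the identity matrix, so the Gram matrix \<open>M\<close> satisfies \<open>M \<ge> 1\<close>, and
  \<open>x M = y\<close> gives \<open>x \<cdot> x \<le> y \<cdot> x\<close>.
\<close>
lemma gram_inverse_contracts:
  fixes x y :: "int \<Rightarrow> real"
  assumes "finite I" "finite E" "z_edge ` I \<subseteq> E"
    and y: "\<And>j. j \<in> I \<Longrightarrow> (\<Sum>i\<in>I. x i * gram E i j) = y j"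
  shows "(\<Sum>j\<in>I. (x j)\<^sup>2) \<le> (\<Sum>j\<in>I. (y j)\<^sup>2)"
proof -
  define c where "c e = (\<Sum>i\<in>I. x i * of_bool (crosses e i))" for e
  have c_y: "(\<Sum>e\<in>E. c e * of_bool (crosses e j)) = y j" if "j \<in> I" for j
    unfolding c_def gram_row_sum[symmetric] by (rule y[OF that])
  have "(\<Sum>j\<in>I. (x j)\<^sup>2) = (\<Sum>j\<in>I. (c (z_edge j))\<^sup>2)"
  proof (intro sum.cong refl)
    fix j assume "j \<in> I"
    have "c (z_edge j) = (\<Sum>i\<in>I. if i = j then x i else 0)"
      unfolding c_def by (intro sum.cong refl) (simp add: crosses_z_edge)
    then show "(x j)\<^sup>2 = (c (z_edge j))\<^sup>2" using assms(1) \<open>j \<in> I\<close> by simp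
  qed
  also have "\<dots> = (\<Sum>e\<in>z_edge ` I. (c e)\<^sup>2)"
    using inj_z_edge by (simp only: sum.reindex[OF inj_on_subset[OF inj_z_edge subset_UNIV]] comp_def)
  also have "\<dots> \<le> (\<Sum>e\<in>E. (c e)\<^sup>2)"
    using assms by (intro sum_mono2) auto
  also have "\<dots> = (\<Sum>e\<in>E. \<Sum>j\<in>I. c e * (x j * of_bool (crosses e j)))"
    by (simp only: power2_eq_square sum_distrib_left[symmetric] c_def)
  also have "\<dots> = (\<Sum>j\<in>I. y j * x j)"
  proof (subst sum.swap, intro sum.cong refl)
    fix j assume j: "j \<in> I"
    show "(\<Sum>e\<in>E. c e * (x j * of_bool (crosses e j))) = y j * x j"
      unfolding c_y[OF j, symmetric] sum_distrib_right by (simp only: mult_ac)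
  qed
  also have "\<dots> \<le> (\<Sum>j\<in>I. ((x j)\<^sup>2 + (y j)\<^sup>2) / 2)"
  proof (rule sum_mono)
    fix j show "y j * x j \<le> ((x j)\<^sup>2 + (y j)\<^sup>2) / 2"
      using zero_le_power2[of "x j - y j"] by (simp add: power2_diff mult_ac)
  qed
  also have "\<dots> = ((\<Sum>j\<in>I. (x j)\<^sup>2) + (\<Sum>j\<in>I. (y j)\<^sup>2)) / 2"
    by (simp add: sum.distrib sum_divide_distrib add_divide_distrib)
  finally show ?thesis by simp
qed

lemma gram_helix3_row_sum:
  fixes x :: "int \<Rightarrow> 'b::comm_ring_1"
  assumes "j \<in> {a+1..b}"
  shows "(\<Sum>i\<in>{a+1..b}. x i * gram (helix3_edges a b) i j)
    = x j + (\<Sum>m\<in>{j..j+2} \<inter> {a+3..b}. x m + x (m - 1) + x (m - 2))"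
proof -
  let ?I = "{a+1..b}" and ?J = "{a+3..b}"
  let ?c = "\<lambda>e. (\<Sum>i\<in>?I. x i * of_bool (crosses e i)) * of_bool (crosses e j)"
  have disj: "z_edge ` ?I \<inter> h_edge ` ?J = {}"
    by (auto simp: z_edge_def h_edge_def doubleton_eq_iff)
  have "(\<Sum>i\<in>?I. x i * gram (helix3_edges a b) i j) = (\<Sum>e\<in>z_edge ` ?I. ?c e) + (\<Sum>e\<in>h_edge ` ?J. ?c e)"
    unfolding gram_row_sum by (rule sum.union_disjoint) (use disj in auto)
  also have "(\<Sum>e\<in>z_edge ` ?I. ?c e) = (\<Sum>s\<in>?I. ?c (z_edge s))"
    by (simp only: sum.reindex[OF inj_on_subset[OF inj_z_edge subset_UNIV]] comp_def)
  also have "\<dots> = (\<Sum>s\<in>?I. if s = j then (\<Sum>i\<in>?I. if i = j then x i else 0) else 0)"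
    by (intro sum.cong refl) (auto simp: crosses_z_edge intro!: sum.cong)
  also have "\<dots> = x j" using assms by simp
  also have "(\<Sum>e\<in>h_edge ` ?J. ?c e) = (\<Sum>m\<in>?J. ?c (h_edge m))"
    by (simp only: sum.reindex[OF inj_on_subset[OF inj_h_edge subset_UNIV]] comp_def)
  also have "\<dots> = (\<Sum>m\<in>{j..j+2} \<inter> ?J. x m + x (m - 1) + x (m - 2))"
  proof (rule sum.mono_neutral_cong_right)
    show "\<forall>m\<in>?J - {j..j+2} \<inter> ?J. ?c (h_edge m) = 0" by (auto simp: crosses_h_edge)
    fix m assume m: "m \<in> {j..j+2} \<inter> ?J"
    have "(\<Sum>i\<in>?I. x i * of_bool (crosses (h_edge m) i)) = (\<Sum>i\<in>{m, m-1, m-2}. x i * of_bool (crosses (h_edge m) i))"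
      using m by (intro sum.mono_neutral_right) (auto simp: crosses_h_edge)
    also have "\<dots> = x m + x (m - 1) + x (m - 2)" by (simp add: crosses_h_edge add.assoc)
    finally show "?c (h_edge m) = x m + x (m - 1) + x (m - 2)"
      using m by (simp add: crosses_h_edge)
  qed auto
  finally show ?thesis .
qed

text \<open>
  The recurrence says that the row \<open>k \<mapsto> F (k - s)\<close> inverts the Gram matrix of the infinite graph. In
  the box only the edges \<open>h_edge m\<close> that leave it are missing, so this row multiplied by the Gram
  matrix of the box differs from the unit row by sums \<open>G m\<close> with \<open>m\<close> just outside the range
  \<open>{a+3..b}\<close> of the available \<open>h_edge m\<close>.
\<close>
lemma finite_section_error:
  fixes F :: "int \<Rightarrow> real" and B :: "int \<Rightarrow> int \<Rightarrow> real"
  assumes rec: "\<And>j. F (j - 2) + 2 * F (j - 1) + 4 * F j + 2 * F (j + 1) + F (j + 2) = of_bool (j = 0)"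
    and s: "s \<in> {a+1..b}" and k: "k \<in> {a+1..b}"
    and B: "\<And>j. j \<in> {a+1..b} \<Longrightarrow>
        (\<Sum>k\<in>{a+1..b}. B s k * gram (helix3_edges a b) k j) = of_bool (s = j)"
  defines "G \<equiv> \<lambda>m. F (m - s) + F (m - 1 - s) + F (m - 2 - s)"
  shows "\<bar>F (k - s) - B s k\<bar> \<le> 2 * (\<Sum>m\<in>{a+1, a+2, b+1, b+2}. \<bar>G m\<bar>)"
proof -
  let ?I = "{a+1..b}" and ?E = "helix3_edges a b" and ?J = "{a+3..b}"
  let ?bd = "{a+1, a+2, b+1, b+2}"
  define \<epsilon> where "\<epsilon> = (\<Sum>m\<in>?bd. \<bar>G m\<bar>)"
  define y where "y j = - (\<Sum>m\<in>{j..j+2} - ?J. G m)" for j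
  have eps: "0 \<le> \<epsilon>" by (simp add: \<epsilon>_def sum_nonneg)
  have y_eq: "(\<Sum>i\<in>?I. (F (i - s) - B s i) * gram ?E i j) = y j" if j: "j \<in> ?I" for j
  proof -
    have "(\<Sum>m\<in>{j..j+2}. G m) = (\<Sum>m\<in>{j..j+2} \<inter> ?J. G m) + (\<Sum>m\<in>{j..j+2} - ?J. G m)"
      by (rule sum.Int_Diff) simp
    moreover have "(\<Sum>m\<in>{j..j+2}. G m) = G j + G (j + 1) + G (j + 2)"
    proof -
      have "{j..j+2} = {j, j+1, j+2}" by auto
      then show ?thesis by simp
    qed
    moreover have "F (j - s) + (G j + G (j + 1) + G (j + 2)) = of_bool (s = j)"
      using rec[of "j - s"] by (simp add: G_def algebra_simps)
    moreover have "(\<Sum>i\<in>?I. F (i - s) * gram ?E i j) = F (j - s) + (\<Sum>m\<in>{j..j+2} \<inter> ?J. G m)"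
      using gram_helix3_row_sum[OF j, of "\<lambda>i. F (i - s)"] by (simp only: G_def)
    ultimately show ?thesis using B[OF j]
      by (simp only: left_diff_distrib sum_subtractf y_def)
  qed
  have y_le: "\<bar>y j\<bar> \<le> \<epsilon>" if j: "j \<in> ?I" for j
  proof -
    have sub: "{j..j+2} - ?J \<subseteq> ?bd"
    proof
      fix m assume "m \<in> {j..j+2} - ?J"
      then have "m = a + 1 \<or> m = a + 2 \<or> m = b + 1 \<or> m = b + 2"
        using j unfolding Diff_iff atLeastAtMost_iff by presburger
      then show "m \<in> ?bd" by blast
    qed
    have "\<bar>y j\<bar> \<le> (\<Sum>m\<in>{j..j+2} - ?J. \<bar>G m\<bar>)" unfolding y_def by (simp add: sum_abs)
    also have "\<dots> \<le> \<epsilon>" unfolding \<epsilon>_def by (rule sum_mono2) (use sub in simp_all)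
    finally show ?thesis .
  qed
  have "(F (k - s) - B s k)\<^sup>2 \<le> (\<Sum>j\<in>?I. (F (j - s) - B s j)\<^sup>2)"
    by (rule member_le_sum[OF k]) auto
  also have "\<dots> \<le> (\<Sum>j\<in>?I. (y j)\<^sup>2)"
    by (rule gram_inverse_contracts[OF _ _ _ y_eq]) auto
  \<comment> \<open>At most four gaps are crossed by a missing edge; this is where the factor \<open>2\<close>, the root of four, comes from.\<close>
  also have "\<dots> = (\<Sum>j\<in>?I \<inter> {a+1, a+2, b-1, b}. (y j)\<^sup>2)"
  proof (rule sum.mono_neutral_right)
    show "\<forall>j\<in>?I - ?I \<inter> {a+1, a+2, b-1, b}. (y j)\<^sup>2 = 0"
    proof
      fix j assume "j \<in> ?I - ?I \<inter> {a+1, a+2, b-1, b}"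
      then have "a + 3 \<le> j" "j + 2 \<le> b" by auto
      then have empty: "{j..j+2} - ?J = {}" by auto
      show "(y j)\<^sup>2 = 0" unfolding y_def empty by simp
    qed
  qed auto
  also have "\<dots> \<le> (\<Sum>j\<in>?I \<inter> {a+1, a+2, b-1, b}. \<epsilon>\<^sup>2)"
    using y_le eps by (intro sum_mono) (auto simp: abs_le_square_iff[symmetric])
  also have "\<dots> \<le> 4 * \<epsilon>\<^sup>2"
  proof -
    have "card (?I \<inter> {a+1, a+2, b-1, b}) \<le> card {a+1, a+2, b-1, b}" by (rule card_mono) auto
    also have "\<dots> \<le> 4" using card_length[of "[a+1, a+2, b-1, b]"] by simp
    finally show ?thesis by (simp add: mult_right_mono)
  qed
  also have "\<dots> = (2 * \<epsilon>)\<^sup>2" by (simp add: power_mult_distrib)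
  finally have "\<bar>F (k - s) - B s k\<bar> \<le> \<bar>2 * \<epsilon>\<bar>" by (simp only: abs_le_square_iff)
  then show ?thesis using eps unfolding \<epsilon>_def[symmetric] by simp
qed

lemma filterlim_int_plus: "filterlim (\<lambda>n. int n + c) at_top sequentially"
  unfolding filterlim_at_top eventually_sequentially
proof
  fix Z show "\<exists>N. \<forall>n\<ge>N. Z \<le> int n + c" by (rule exI[of _ "nat (Z - c)"]) auto
qed

lemma filterlim_minus_int_plus: "filterlim (\<lambda>n. - int n + c) at_bot sequentially"
  unfolding filterlim_at_bot eventually_sequentially
proof
  fix Z show "\<exists>N. \<forall>n\<ge>N. - int n + c \<le> Z" by (rule exI[of _ "nat (c - Z)"]) auto
qed

text \<open>
  By \<open>finite_section_error\<close> the entries of the inverse Gram matrices converge to those of the Toeplitz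
  matrix of \<open>F\<close>, and a determinant of fixed size is continuous in the entries.
\<close>
theorem ust_helix3_limit:
  fixes F :: "int \<Rightarrow> real"
  assumes rec: "\<And>j. F (j - 2) + 2 * F (j - 1) + 4 * F j + 2 * F (j + 1) + F (j + 2) = of_bool (j = 0)"
    and top: "(F \<longlongrightarrow> 0) at_top" and bot: "(F \<longlongrightarrow> 0) at_bot"
    and "finite S"
  shows "(\<lambda>n. measure_pmf.prob (pmf_of_set (spanning_trees (helix3_sub (- int n) (int n)))) {t. z_edge ` S \<subseteq> t})
    \<longlonglongrightarrow> set_det S (\<lambda>i j. F (j - i))"
proof -
  let ?I = "\<lambda>n. {- int n + 1..int n}"
  have "\<exists>B::int \<Rightarrow> int \<Rightarrow> real. \<forall>i\<in>?I n. \<forall>j\<in>?I n.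
      (\<Sum>k\<in>?I n. B i k * gram (helix3_edges (- int n) (int n)) k j) = of_bool (i = j)" for n
  proof -
    let ?T = "spanning_trees (helix3_sub (- int n) (int n))"
    have "finite ?T" unfolding helix3_sub_eq by (rule finite_spanning_trees) simp
    then have "card ?T \<noteq> 0" using spanning_trees_helix3_nonempty[of "- int n" "int n"] by simp
    then have "set_det (?I n) (gram (helix3_edges (- int n) (int n))) \<noteq> (0::real)"
      using card_forced_helix3[of "- int n" "int n" "{}"] by simp
    then show ?thesis by (intro exists_left_inverse) simp_all
  qed
  from choice[OF allI[OF this]] obtain B :: "nat \<Rightarrow> int \<Rightarrow> int \<Rightarrow> real" where
    "\<forall>n. \<forall>i\<in>?I n. \<forall>j\<in>?I n.
      (\<Sum>k\<in>?I n. B n i k * gram (helix3_edges (- int n) (int n)) k j) = of_bool (i = j)" ..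
  then have B: "(\<Sum>k\<in>?I n. B n i k * gram (helix3_edges (- int n) (int n)) k j) = of_bool (i = j)"
    if "i \<in> ?I n" "j \<in> ?I n" for n i j
    using that by blast
  have ev_in: "eventually (\<lambda>n. s \<in> ?I n) sequentially" for s
    unfolding eventually_sequentially by (rule exI[of _ "nat \<bar>s\<bar> + 1"]) auto
  have B_lim: "(\<lambda>n. B n s k) \<longlonglongrightarrow> F (k - s)" for s k
  proof -
    define G where "G m = F (m - s) + F (m - 1 - s) + F (m - 2 - s)" for m
    have Ftop: "(\<lambda>n. F (int n + c)) \<longlonglongrightarrow> 0" for c
      using filterlim_compose[OF top filterlim_int_plus] .
    have Fbot: "(\<lambda>n. F (- int n + c)) \<longlonglongrightarrow> 0" for c
      using filterlim_compose[OF bot filterlim_minus_int_plus] .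
    have shift: "x + c - s = x + (c - s)" "x + c - 1 - s = x + (c - 1 - s)"
        "x + c - 2 - s = x + (c - 2 - s)" for x c :: int by simp_all
    have Gtop: "(\<lambda>n. G (int n + c)) \<longlonglongrightarrow> 0" for c
      unfolding G_def shift by (intro tendsto_add_zero Ftop)
    have Gbot: "(\<lambda>n. G (- int n + c)) \<longlonglongrightarrow> 0" for c
      unfolding G_def shift by (intro tendsto_add_zero Fbot)
    have bound: "eventually (\<lambda>n. norm (B n s k - F (k - s))
        \<le> 2 * (\<bar>G (- int n + 1)\<bar> + \<bar>G (- int n + 2)\<bar> + \<bar>G (int n + 1)\<bar> + \<bar>G (int n + 2)\<bar>)) sequentially"
      using ev_in[of s] ev_in[of k] eventually_ge_at_top[of "2::nat"]
    proof eventually_elim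
      case (elim n)
      have "\<bar>F (k - s) - B n s k\<bar> \<le> 2 * (\<Sum>m\<in>{- int n + 1, - int n + 2, int n + 1, int n + 2}. \<bar>G m\<bar>)"
        unfolding G_def by (rule finite_section_error[where F = F and B = "B n", OF rec elim(1,2) B[OF elim(1)]])
      also have "(\<Sum>m\<in>{- int n + 1, - int n + 2, int n + 1, int n + 2}. \<bar>G m\<bar>)
         = \<bar>G (- int n + 1)\<bar> + \<bar>G (- int n + 2)\<bar> + \<bar>G (int n + 1)\<bar> + \<bar>G (int n + 2)\<bar>"
        using elim(3) by simp
      finally show ?case by (simp add: abs_minus_commute)
    qed
    have "(\<lambda>n. 2 * (\<bar>G (- int n + 1)\<bar> + \<bar>G (- int n + 2)\<bar> + \<bar>G (int n + 1)\<bar> + \<bar>G (int n + 2)\<bar>))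
        \<longlonglongrightarrow> 0"
      by (intro tendsto_mult_right_zero tendsto_add_zero tendsto_rabs_zero Gtop Gbot)
    then have "(\<lambda>n. B n s k - F (k - s)) \<longlonglongrightarrow> 0"
      by (rule Lim_null_comparison[OF bound])
    then show ?thesis by (rule LIM_zero_cancel)
  qed
  have "(\<lambda>n. set_det S (B n)) \<longlonglongrightarrow> set_det S (\<lambda>i j. F (j - i))"
    unfolding set_det_def by (intro tendsto_sum tendsto_mult tendsto_const tendsto_prod B_lim)
  moreover have "eventually (\<lambda>n. set_det S (B n) = measure_pmf.prob (pmf_of_set (spanning_trees (helix3_sub (- int n) (int n)))) {t. z_edge ` S \<subseteq> t}) sequentially"
  proof -
    have "eventually (\<lambda>n. \<forall>s\<in>S. s \<in> ?I n) sequentially"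
      using assms(4) ev_in by (simp add: eventually_ball_finite)
    then show ?thesis
    proof eventually_elim
      case (elim n)
      show ?case by (rule prob_forced_edges[symmetric, OF _ _ B]) (use elim in auto)
    qed
  qed
  ultimately show ?thesis by (rule Lim_transform_eventually)
qed

section \<open>Integrals of geometric series on the circle\<close>

definition expi :: "int \<Rightarrow> real \<Rightarrow> complex" where
  "expi k x = exp (2 * pi * \<i> * of_int k * of_real x)"

lemma expi_add: "expi (k + l) x = expi k x * expi l x"
  by (simp add: expi_def exp_add[symmetric] algebra_simps)

lemma expi_0 [simp]: "expi 0 x = 1"
  by (simp add: expi_def)

lemma norm_expi [simp]: "norm (expi k x) = 1"
  by (simp add: expi_def norm_exp_eq_Re)

lemma cnj_expi: "cnj (expi k x) = expi (- k) x"
  by (simp add: expi_def exp_cnj)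

lemma expi_power: "expi k x ^ n = expi (int n * k) x"
  by (induction n) (simp_all add: expi_add[symmetric] algebra_simps)

lemma expi_minus: "expi (- k) x = exp (- (2 * pi * \<i> * of_int k * of_real x))"
  by (simp add: expi_def)

lemma Re_expi_1: "Re (expi 1 x) = cos (2 * pi * x)"
  by (simp add: expi_def Re_exp)

lemma continuous_on_expi [continuous_intros]: "continuous_on A (expi k)"
  unfolding expi_def by (intro continuous_intros)

lemma has_integral_expi: "(expi k has_integral of_bool (k = 0)) {0..1}"
proof (cases "k = 0")
  case True
  then have "expi k = (\<lambda>x. 1)" by (simp add: fun_eq_iff)
  then show ?thesis using True has_integral_const_real[of "1::complex" 0 1] by simp
next
  case False
  define c where "c = 2 * pi * \<i> * of_int k"
  have c: "c \<noteq> 0" using False by (simp add: c_def)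
  have ex: "expi k x = exp (c * of_real x)" for x by (simp add: expi_def c_def)
  have "((\<lambda>x. exp (c * of_real x)) has_integral exp (c * of_real 1) / c - exp (c * of_real 0) / c) {0..1}"
  proof (rule fundamental_theorem_of_calculus)
    fix x :: real
    have "((\<lambda>z. exp (c * z) / c) has_field_derivative exp (c * of_real x)) (at (of_real x))"
      by (rule derivative_eq_intros refl | simp add: c)+
    then show "((\<lambda>x. exp (c * of_real x) / c) has_vector_derivative exp (c * of_real x)) (at x within {0..1})"
      by (rule has_vector_derivative_real_field)
  qed simp
  moreover have "exp (c * of_real 1) = 1"
    unfolding exp_eq_1 by (auto simp: c_def intro!: exI[of _ k])
  ultimately show ?thesis using False by (simp add: ex[abs_def])
qed

text \<open>
  The geometric series converges boundedly, so it may be integrated term by term, and at most one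
  term has a nonzero integral. The sign \<open>\<sigma>\<close> covers the series in \<open>w\<close> and in its inverse.
\<close>
lemma has_integral_geometric_expi:
  assumes a: "norm a < 1" and \<sigma>: "\<bar>\<sigma>\<bar> = (1::int)"
  shows "((\<lambda>x. expi k x / (1 - a * expi \<sigma> x)) has_integral
    (if 0 \<le> - \<sigma> * k then a ^ nat (- \<sigma> * k) else 0)) {0..1}"
proof (rule has_integral_dominated_convergence)
  let ?f = "\<lambda>N x. \<Sum>n<N. a ^ n * expi (\<sigma> * int n + k) x"
  have f_eq: "?f N x = expi k x * (\<Sum>n<N. (a * expi \<sigma> x) ^ n)" for N x
    unfolding sum_distrib_left by (intro sum.cong refl) (simp add: expi_add expi_power power_mult_distrib mult_ac)
  show "(?f N has_integral (\<Sum>n<N. a ^ n * of_bool (\<sigma> * int n + k = 0))) {0..1}" for N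
    by (intro has_integral_sum has_integral_mult_right has_integral_expi) simp
  show "(\<lambda>x. 1 / (1 - norm a)) integrable_on {0..1::real}" by (rule integrable_const_ivl)
  show "\<forall>x\<in>{0..1}. norm (?f N x) \<le> 1 / (1 - norm a)" for N
  proof
    fix x :: real
    have "norm (?f N x) \<le> (\<Sum>n<N. norm (a ^ n * expi (\<sigma> * int n + k) x))" by (rule norm_sum)
    also have "\<dots> = (\<Sum>n<N. norm a ^ n)" by (simp add: norm_mult norm_power)
    also have "\<dots> \<le> (\<Sum>n. norm a ^ n)"
      by (rule sum_le_suminf) (use a in \<open>auto intro: summable_geometric\<close>)
    also have "\<dots> = 1 / (1 - norm a)" by (rule suminf_geometric) (use a in simp)
    finally show "norm (?f N x) \<le> 1 / (1 - norm a)" .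
  qed
  show "\<forall>x\<in>{0..1}. (\<lambda>N. ?f N x) \<longlonglongrightarrow> expi k x / (1 - a * expi \<sigma> x)"
  proof
    fix x :: real
    have "(\<lambda>n. (a * expi \<sigma> x) ^ n) sums (1 / (1 - a * expi \<sigma> x))"
      by (rule geometric_sums) (use a in \<open>simp add: norm_mult\<close>)
    then have "(\<lambda>N. expi k x * (\<Sum>n<N. (a * expi \<sigma> x) ^ n)) \<longlonglongrightarrow> expi k x * (1 / (1 - a * expi \<sigma> x))"
      unfolding sums_def by (rule tendsto_mult_left)
    then show "(\<lambda>N. ?f N x) \<longlonglongrightarrow> expi k x / (1 - a * expi \<sigma> x)" by (simp add: f_eq)
  qed
  show "(\<lambda>N. \<Sum>n<N. a ^ n * of_bool (\<sigma> * int n + k = 0)) \<longlonglongrightarrow>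
      (if 0 \<le> - \<sigma> * k then a ^ nat (- \<sigma> * k) else 0)"
  proof (rule tendsto_eventually)
    have iff: "\<sigma> * int n + k = 0 \<longleftrightarrow> 0 \<le> - \<sigma> * k \<and> n = nat (- \<sigma> * k)" for n
    proof -
      have "\<sigma> = 1 \<or> \<sigma> = -1" using \<sigma> by linarith
      then show ?thesis by auto
    qed
    show "eventually (\<lambda>N. (\<Sum>n<N. a ^ n * of_bool (\<sigma> * int n + k = 0))
        = (if 0 \<le> - \<sigma> * k then a ^ nat (- \<sigma> * k) else 0)) sequentially"
      using eventually_gt_at_top[of "nat (- \<sigma> * k)"]
    proof eventually_elim
      case (elim N)
      have "(\<Sum>n<N. a ^ n * of_bool (\<sigma> * int n + k = 0))
          = (\<Sum>n<N. if n = nat (- \<sigma> * k) then (if 0 \<le> - \<sigma> * k then a ^ n else 0) else 0)"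
        unfolding iff by (intro sum.cong refl) auto
      also have "\<dots> = (if 0 \<le> - \<sigma> * k then a ^ nat (- \<sigma> * k) else 0)"
        using elim by simp
      finally show ?case .
    qed
  qed
qed

lemma has_integral_two_sided_geometric:
  assumes "norm a < 1"
  shows "((\<lambda>x. (1 / (1 - a * expi 1 x) + 1 / (1 - a * expi (- 1) x) - 1) * expi (- k) x)
    has_integral a ^ nat \<bar>k\<bar>) {0..1}"
proof -
  have "((\<lambda>x. expi (- k) x / (1 - a * expi 1 x) + expi (- k) x / (1 - a * expi (- 1) x) - expi (- k) x)
    has_integral ((if 0 \<le> - 1 * - k then a ^ nat (- 1 * - k) else 0)
       + (if 0 \<le> - (- 1) * - k then a ^ nat (- (- 1) * - k) else 0) - of_bool (- k = 0))) {0..1}"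
    by (intro has_integral_diff has_integral_add has_integral_geometric_expi has_integral_expi assms) simp_all
  also have "(if 0 \<le> - 1 * - k then a ^ nat (- 1 * - k) else 0)
       + (if 0 \<le> - (- 1) * - k then a ^ nat (- (- 1) * - k) else 0) - of_bool (- k = 0) = a ^ nat \<bar>k\<bar>"
    by (cases k "0::int" rule: linorder_cases) auto
  finally show ?thesis by (simp add: algebra_simps)
qed

section \<open>The Fourier coefficients of the inverse symbol\<close>

text \<open>
  Here \<open>g\<close> and \<open>h\<close> are the powers \<open>\<gamma> powr (3/2)\<close> and \<open>\<gamma> powr (-3/2)\<close>; all that matters about the golden
  ratio \<open>\<gamma>\<close> are the two algebraic relations between them.
\<close>
locale helix_constants =
  fixes g h :: real and \<eta> \<alpha> :: complex
  assumes pos: "0 < g" "0 < h" and gh: "g * h = 1" and sq: "g\<^sup>2 = h\<^sup>2 + 4"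
    and eta: "\<eta> = Complex (g / (4 * sqrt 5)) (h / (4 * sqrt 5))"
    and alpha: "\<alpha> = Complex ((h - 1) / 2) ((g - 1) / 2)"
begin

lemma sqrt5: "g\<^sup>2 + h\<^sup>2 = 2 * sqrt 5"
proof (rule power2_eq_imp_eq)
  have "(g\<^sup>2 + h\<^sup>2)\<^sup>2 = (g\<^sup>2 - h\<^sup>2)\<^sup>2 + 4 * (g * h)\<^sup>2" by (simp add: power2_eq_square algebra_simps)
  also have "\<dots> = 20" using sq gh by simp
  finally show "(g\<^sup>2 + h\<^sup>2)\<^sup>2 = (2 * sqrt 5)\<^sup>2" by (simp add: power_mult_distrib)
qed auto

text \<open>
  So \<open>\<alpha> + 1 / \<alpha> = - 1 - \<i>\<close>: the symbol \<open>1 + (1 + w + 1 / w)\<^sup>2\<close> vanishes at \<open>\<alpha>\<close>.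
\<close>
lemma alpha_sq: "\<alpha>\<^sup>2 = - (1 + \<i>) * \<alpha> - 1"
  using sq gh by (simp add: complex_eq_iff alpha power2_eq_square field_simps)

lemma norm_alpha: "norm \<alpha> < 1"
proof -
  have "2 < g" by (rule power2_less_imp_less) (use sq pos in auto)
  moreover define r where "r = sqrt 5"
  moreover have "r < 3" unfolding r_def by (rule real_less_lsqrt) auto
  ultimately have "2 * r + 2 - 2 * (g + h) < 4" using pos by (simp add: algebra_simps)
  then have "((h - 1) / 2)\<^sup>2 + ((g - 1) / 2)\<^sup>2 < 1"
    unfolding r_def sqrt5[symmetric] by (simp add: power2_eq_square field_simps)
  then show ?thesis by (simp add: alpha cmod_def real_sqrt_lt_1_iff)
qed

lemma eta_scaled: "of_real (2 * (g\<^sup>2 + h\<^sup>2)) * \<eta> = Complex g h"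
  by (simp add: eta complex_eq_iff sqrt5)

lemma scale_nonzero: "of_real (2 * (g\<^sup>2 + h\<^sup>2)) \<noteq> (0::complex)"
  unfolding of_real_eq_0_iff using pos by (simp add: sqrt5)

text \<open>
  This identity makes \<open>\<eta>\<close> the right coefficient at the pole in \<open>partial_fractions\<close>.
\<close>
lemma eta_alpha: "\<eta> * (1 - \<alpha>\<^sup>2) = - (\<i> / 2) * \<alpha>"
proof -
  let ?s = "of_real (2 * (g\<^sup>2 + h\<^sup>2)) :: complex"
  have "?s * (\<eta> * (1 - \<alpha>\<^sup>2)) = Complex g h * (2 + (1 + \<i>) * \<alpha>)"
    unfolding mult.assoc[symmetric] eta_scaled alpha_sq by (simp add: algebra_simps)
  also have "\<dots> = Complex ((g * (4 + h - g) - h * (g + h - 2)) / 2) ((g * (g + h - 2) + h * (4 + h - g)) / 2)"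
    by (simp add: complex_eq_iff alpha field_simps)
  also have "g * (4 + h - g) - h * (g + h - 2) = (g\<^sup>2 + h\<^sup>2) * (g - 1)"
    using gh sq by Groebner_Basis.algebra
  also have "g * (g + h - 2) + h * (4 + h - g) = - (g\<^sup>2 + h\<^sup>2) * (h - 1)"
    using gh sq by Groebner_Basis.algebra
  also have "Complex ((g\<^sup>2 + h\<^sup>2) * (g - 1) / 2) (- (g\<^sup>2 + h\<^sup>2) * (h - 1) / 2) = ?s * (- (\<i> / 2) * \<alpha>)"
    by (simp add: complex_eq_iff alpha field_simps)
  finally show ?thesis using scale_nonzero by (metis mult_left_cancel)
qed

definition fcoeff :: "int \<Rightarrow> real" where
  "fcoeff m = 2 * Re (\<eta> * \<alpha> ^ nat \<bar>m\<bar>)"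

lemma of_real_fcoeff:
  "of_real (fcoeff m) = \<eta> * \<alpha> ^ nat \<bar>m\<bar> + cnj \<eta> * cnj \<alpha> ^ nat \<bar>m\<bar>"
  using complex_add_cnj[of "\<eta> * \<alpha> ^ nat \<bar>m\<bar>"] by (simp add: fcoeff_def)

lemma fcoeff_minus: "fcoeff (- m) = fcoeff m"
  by (simp add: fcoeff_def)

text \<open>
  The polynomial is \<open>w\<^sup>2\<close> times the symbol; its two factors over the Gaussian integers belong to \<open>\<alpha>\<close>
  and its conjugate.
\<close>
lemma char_poly: "\<alpha> ^ 4 + 2 * \<alpha> ^ 3 + 4 * \<alpha>\<^sup>2 + 2 * \<alpha> + 1 = 0"
proof -
  have "\<alpha> ^ 4 + 2 * \<alpha> ^ 3 + 4 * \<alpha>\<^sup>2 + 2 * \<alpha> + 1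
      = (\<alpha>\<^sup>2 + (1 + \<i>) * \<alpha> + 1) * (\<alpha>\<^sup>2 + (1 - \<i>) * \<alpha> + 1)"
    by (simp add: algebra_simps power2_eq_square power3_eq_cube power4_eq_xxxx)
  also have "\<alpha>\<^sup>2 + (1 + \<i>) * \<alpha> + 1 = 0" by (simp add: alpha_sq algebra_simps)
  finally show ?thesis by (simp only: mult_zero_left)
qed

text \<open>
  For \<open>j \<ge> 2\<close> all exponents are those of a geometric progression, and the characteristic polynomial
  vanishes. For \<open>j = 0\<close> and \<open>j = 1\<close> the absolute value in the exponent matters, and the value of \<open>\<eta>\<close>
  enters.
\<close>
lemma fcoeff_recurrence_nonneg:
  assumes "0 \<le> j"
  shows "fcoeff (j - 2) + 2 * fcoeff (j - 1) + 4 * fcoeff j + 2 * fcoeff (j + 1) + fcoeff (j + 2) = of_bool (j = 0)"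
proof -
  let ?s = "of_real (2 * (g\<^sup>2 + h\<^sup>2)) :: complex"
  consider "j = 0" | "j = 1" | "2 \<le> j" using assms by linarith
  then show ?thesis
  proof cases
    case 1
    have "?s * (\<eta> * ((2 - 2 * \<i>) * \<alpha> + 2)) = Complex g h * Complex (g + h) (g - h)"
      unfolding mult.assoc[symmetric] eta_scaled by (simp add: alpha complex_eq_iff field_simps)
    then have "Re (?s * (\<eta> * ((2 - 2 * \<i>) * \<alpha> + 2))) = g\<^sup>2 + h\<^sup>2"
      by (simp add: algebra_simps power2_eq_square)
    then have "2 * (g\<^sup>2 + h\<^sup>2) * Re (\<eta> * ((2 - 2 * \<i>) * \<alpha> + 2)) = g\<^sup>2 + h\<^sup>2"
      by (simp only: Re_complex_of_real Im_complex_of_real times_complex.sel mult_zero_left diff_zero)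
    then have half: "Re (\<eta> * ((2 - 2 * \<i>) * \<alpha> + 2)) = 1 / 2"
      unfolding sqrt5 by (simp only: mult.assoc) simp
    have "2 * fcoeff 2 + 4 * fcoeff 1 + 4 * fcoeff 0 = 2 * Re (2 * (\<eta> * \<alpha>\<^sup>2) + 4 * (\<eta> * \<alpha>) + 4 * \<eta>)"
      by (simp add: fcoeff_def)
    also have "2 * (\<eta> * \<alpha>\<^sup>2) + 4 * (\<eta> * \<alpha>) + 4 * \<eta> = \<eta> * ((2 - 2 * \<i>) * \<alpha> + 2)"
      by (simp add: alpha_sq algebra_simps)
    finally have "2 * fcoeff 2 + 4 * fcoeff 1 + 4 * fcoeff 0 = 1" unfolding half by simp
    then show ?thesis using 1 fcoeff_minus[of 2] fcoeff_minus[of 1] by simp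
  next
    case 2
    have "\<alpha> ^ 3 = \<alpha> * \<alpha>\<^sup>2" by (simp add: power3_eq_cube power2_eq_square)
    also have "\<dots> = \<alpha> * (- (1 + \<i>) * \<alpha> - 1)" by (simp only: alpha_sq)
    also have "\<dots> = - (1 + \<i>) * \<alpha>\<^sup>2 - \<alpha>" by (simp add: algebra_simps power2_eq_square)
    also have "\<dots> = - (1 + \<i>) * (- (1 + \<i>) * \<alpha> - 1) - \<alpha>" by (simp only: alpha_sq)
    also have "\<dots> = (2 * \<i> - 1) * \<alpha> + (1 + \<i>)" by (simp add: algebra_simps)
    finally have cube: "\<alpha> ^ 3 = (2 * \<i> - 1) * \<alpha> + (1 + \<i>)" .
    have "fcoeff 3 + 2 * fcoeff 2 + 5 * fcoeff 1 + 2 * fcoeff 0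
        = 2 * Re (\<eta> * \<alpha> ^ 3 + 2 * (\<eta> * \<alpha>\<^sup>2) + 5 * (\<eta> * \<alpha>) + 2 * \<eta>)"
      by (simp add: fcoeff_def)
    also have "\<eta> * \<alpha> ^ 3 + 2 * (\<eta> * \<alpha>\<^sup>2) + 5 * (\<eta> * \<alpha>) + 2 * \<eta> = \<eta> * (2 * \<alpha> + 1 + \<i>)"
      unfolding cube alpha_sq by (simp add: algebra_simps)
    also have "Re (\<eta> * (2 * \<alpha> + 1 + \<i>)) = 0"
    proof -
      have "2 * \<alpha> + 1 + \<i> = Complex h g" by (simp add: alpha complex_eq_iff field_simps)
      then show ?thesis by (simp add: eta)
    qed
    finally show ?thesis using 2 fcoeff_minus[of 1] by simp
  next
    case 3
    define n where "n = nat (j - 2)"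
    have n: "nat \<bar>j - 2\<bar> = n" "nat \<bar>j - 1\<bar> = n + 1" "nat \<bar>j\<bar> = n + 2" "nat \<bar>j + 1\<bar> = n + 3" "nat \<bar>j + 2\<bar> = n + 4"
      using 3 by (auto simp: n_def)
    have "fcoeff (j - 2) + 2 * fcoeff (j - 1) + 4 * fcoeff j + 2 * fcoeff (j + 1) + fcoeff (j + 2)
      = 2 * Re (\<eta> * \<alpha> ^ n + 2 * (\<eta> * \<alpha> ^ (n + 1)) + 4 * (\<eta> * \<alpha> ^ (n + 2)) + 2 * (\<eta> * \<alpha> ^ (n + 3)) + \<eta> * \<alpha> ^ (n + 4))"
      unfolding fcoeff_def n by simp
    also have "\<eta> * \<alpha> ^ n + 2 * (\<eta> * \<alpha> ^ (n + 1)) + 4 * (\<eta> * \<alpha> ^ (n + 2)) + 2 * (\<eta> * \<alpha> ^ (n + 3)) + \<eta> * \<alpha> ^ (n + 4)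
      = \<eta> * \<alpha> ^ n * (\<alpha> ^ 4 + 2 * \<alpha> ^ 3 + 4 * \<alpha>\<^sup>2 + 2 * \<alpha> + 1)"
      by (simp add: power_add power2_eq_square power3_eq_cube power4_eq_xxxx algebra_simps)
    also have "\<dots> = 0" by (simp only: char_poly mult_zero_right)
    finally show ?thesis using 3 by simp
  qed
qed

lemma fcoeff_recurrence:
  "fcoeff (j - 2) + 2 * fcoeff (j - 1) + 4 * fcoeff j + 2 * fcoeff (j + 1) + fcoeff (j + 2) = of_bool (j = 0)"
proof (cases "0 \<le> j")
  case True then show ?thesis by (rule fcoeff_recurrence_nonneg)
next
  case False
  have "fcoeff (j - 2) = fcoeff (- j + 2)" "fcoeff (j - 1) = fcoeff (- j + 1)" "fcoeff j = fcoeff (- j)"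
    "fcoeff (j + 1) = fcoeff (- j - 1)" "fcoeff (j + 2) = fcoeff (- j - 2)"
    using fcoeff_minus[of "j - 2"] fcoeff_minus[of "j - 1"] fcoeff_minus[of j] fcoeff_minus[of "j + 1"] fcoeff_minus[of "j + 2"]
    by (simp_all add: minus_diff_eq minus_add)
  then show ?thesis using fcoeff_recurrence_nonneg[of "- j"] False by simp
qed

lemma fcoeff_at_top: "(fcoeff \<longlongrightarrow> 0) at_top"
proof -
  have "(\<lambda>n. \<alpha> ^ n) \<longlonglongrightarrow> 0" by (rule LIMSEQ_power_zero[OF norm_alpha])
  then have "(\<lambda>n. 2 * Re (\<eta> * \<alpha> ^ n)) \<longlonglongrightarrow> 2 * Re (\<eta> * 0)"
    by (rule tendsto_mult[OF tendsto_const tendsto_Re[OF tendsto_mult[OF tendsto_const]]])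
  then have lim: "(\<lambda>n. 2 * Re (\<eta> * \<alpha> ^ n)) \<longlonglongrightarrow> 0" by simp
  have "filterlim nat sequentially (at_top :: int filter)"
    unfolding filterlim_at_top
  proof
    fix Z show "eventually (\<lambda>x. Z \<le> nat x) (at_top :: int filter)"
      using eventually_ge_at_top[of "int Z"] by eventually_elim simp
  qed
  from filterlim_compose[OF lim this] show ?thesis
  proof (rule Lim_transform_eventually)
    show "eventually (\<lambda>m. 2 * Re (\<eta> * \<alpha> ^ nat m) = fcoeff m) at_top"
      using eventually_ge_at_top[of 0] by eventually_elim (simp add: fcoeff_def)
  qed
qed

lemma fcoeff_at_bot: "(fcoeff \<longlongrightarrow> 0) at_bot"
proof -
  have "filterlim uminus at_top (at_bot :: int filter)"
    unfolding filterlim_at_top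
  proof
    fix Z show "eventually (\<lambda>x. Z \<le> - x) (at_bot :: int filter)"
      using eventually_le_at_bot[of "- Z"] by eventually_elim simp
  qed
  from filterlim_compose[OF fcoeff_at_top this] show ?thesis by (simp add: fcoeff_minus)
qed

text \<open>
  With \<open>w = exp (2 \<pi> \<i> x)\<close> and \<open>u = 1 + 2 cos (2 \<pi> x)\<close> one has \<open>f = 1 / (1 + u\<^sup>2) = 2 Re ((\<i> / 2) / (u + \<i>))\<close>,
  and \<open>(1 - \<alpha> w) (1 - \<alpha> / w) = - \<alpha> (u + \<i>)\<close> splits \<open>1 / (u + \<i>)\<close> into two geometric series.
\<close>
lemma partial_fractions:
  assumes f: "f = 1 / (4 + 4 * cos (2 * pi * x) + 2 * cos (4 * pi * x))"
  shows "complex_of_real f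
    = \<eta> * (1 / (1 - \<alpha> * expi 1 x) + 1 / (1 - \<alpha> * expi (- 1) x) - 1)
    + cnj \<eta> * (1 / (1 - cnj \<alpha> * expi 1 x) + 1 / (1 - cnj \<alpha> * expi (- 1) x) - 1)"
proof -
  define u where "u = 1 + 2 * cos (2 * pi * x)"
  define w v where "w = expi 1 x" and "v = expi (- 1) x"
  have wv: "w * v = 1" unfolding w_def v_def expi_add[symmetric] by simp
  have v_cnj: "v = cnj w" by (simp add: w_def v_def cnj_expi)
  have sum: "w + v = of_real (u - 1)"
    unfolding v_cnj complex_add_cnj by (simp add: w_def Re_expi_1 u_def)
  have nz: "1 - \<alpha> * w \<noteq> 0" "1 - \<alpha> * v \<noteq> 0"
    using norm_alpha norm_mult[of \<alpha> w] norm_mult[of \<alpha> v] by (auto simp: w_def v_def)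
  have alpha_nz: "\<alpha> \<noteq> 0"
  proof
    assume "\<alpha> = 0"
    then have "h = 1" "g = 1" by (simp_all add: alpha complex_eq_iff)
    then show False using sq by simp
  qed
  have u_nz: "of_real u + \<i> \<noteq> 0" by (simp add: complex_eq_iff)
  define Q where "Q = 1 / (1 - \<alpha> * w) + 1 / (1 - \<alpha> * v) - 1"
  define P where "P = \<eta> * Q"
  have "(1 - \<alpha> * w) * (1 - \<alpha> * v) = 1 + \<alpha>\<^sup>2 * (w * v) - \<alpha> * (w + v)" by (simp add: algebra_simps power2_eq_square)
  also have "\<dots> = - \<alpha> * (of_real u + \<i>)"
    unfolding wv sum alpha_sq by (simp add: algebra_simps)
  finally have prod: "(1 - \<alpha> * w) * (1 - \<alpha> * v) = - \<alpha> * (of_real u + \<i>)" .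
  have "Q * ((1 - \<alpha> * w) * (1 - \<alpha> * v)) = (1 - \<alpha> * w) + (1 - \<alpha> * v) - (1 - \<alpha> * w) * (1 - \<alpha> * v)"
  proof -
    have "(1 / p + 1 / q - 1) * (p * q) = p + q - p * q" if "p \<noteq> 0" "q \<noteq> 0" for p q :: complex
      using that by (simp add: field_simps)
    then show ?thesis unfolding Q_def using nz by blast
  qed
  also have "\<dots> = 1 - \<alpha>\<^sup>2 * (w * v)" by (simp add: algebra_simps power2_eq_square)
  finally have "P * (- \<alpha> * (of_real u + \<i>)) = \<eta> * (1 - \<alpha>\<^sup>2)"
    unfolding prod wv P_def by (simp only: mult.assoc mult_1_right)
  also have "\<dots> = - (\<i> / 2) * \<alpha>" by (rule eta_alpha)
  finally have "\<alpha> * (P * (of_real u + \<i>)) = \<alpha> * (\<i> / 2)" by (simp add: mult_ac)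
  then have "P * (of_real u + \<i>) = \<i> / 2" by (rule mult_left_cancel[OF alpha_nz, THEN iffD1])
  then have P: "P = (\<i> / 2) / (of_real u + \<i>)" by (rule eq_divide_imp[OF u_nz])
  have "cnj \<eta> * (1 / (1 - cnj \<alpha> * w) + 1 / (1 - cnj \<alpha> * v) - 1) = cnj P"
    by (simp add: P_def Q_def v_cnj add.commute)
  then have "P + cnj \<eta> * (1 / (1 - cnj \<alpha> * w) + 1 / (1 - cnj \<alpha> * v) - 1) = of_real (2 * Re P)"
    by (simp only: complex_add_cnj)
  also have "2 * Re P = 1 / (1 + u\<^sup>2)"
  proof -
    have "1 + u * u \<noteq> 0" using sum_squares_eq_zero_iff[of 1 u] by simp
    then show ?thesis unfolding P by (simp add: Re_divide power2_eq_square add.commute field_simps)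
  qed
  also have "\<dots> = f"
  proof -
    have "cos (4 * pi * x) = 2 * (cos (2 * pi * x))\<^sup>2 - 1"
      using cos_double_cos[of "2 * pi * x"] by (simp add: mult_ac)
    then show ?thesis unfolding f u_def by (simp add: power2_eq_square algebra_simps)
  qed
  finally show ?thesis unfolding P_def Q_def w_def v_def by (rule sym)
qed

lemma has_integral_fourier_fcoeff:
  "((\<lambda>x. complex_of_real (1 / (4 + 4 * cos (2 * pi * x) + 2 * cos (4 * pi * x))) * expi (- k) x)
    has_integral of_real (fcoeff k)) {0..1}"
proof -
  have "((\<lambda>x. \<eta> * ((1 / (1 - \<alpha> * expi 1 x) + 1 / (1 - \<alpha> * expi (- 1) x) - 1) * expi (- k) x)
    + cnj \<eta> * ((1 / (1 - cnj \<alpha> * expi 1 x) + 1 / (1 - cnj \<alpha> * expi (- 1) x) - 1) * expi (- k) x))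
    has_integral (\<eta> * \<alpha> ^ nat \<bar>k\<bar> + cnj \<eta> * cnj \<alpha> ^ nat \<bar>k\<bar>)) {0..1}"
    by (intro has_integral_add has_integral_mult_right has_integral_two_sided_geometric)
       (use norm_alpha in simp_all)
  then show ?thesis
    unfolding partial_fractions[OF refl] of_real_fcoeff by (simp only: distrib_right mult.assoc)
qed

end

section \<open>Uniqueness of Fourier transforms\<close>

lemma AE_zero_if_integral_zero:
  fixes f :: "'n::euclidean_space \<Rightarrow> real"
  assumes int: "(f has_integral 0) S" and nonneg: "\<And>x. x \<in> S \<Longrightarrow> 0 \<le> f x"
  shows "AE x in lebesgue. x \<in> S \<longrightarrow> f x = 0"
proof -
  have abs: "f absolutely_integrable_on S"
    using int nonneg by (intro nonnegative_absolutely_integrable_1) (auto simp: integrable_on_def)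
  have "integral\<^sup>L lebesgue (\<lambda>x. indicator S x *\<^sub>R f x) = integral S f"
    using set_lebesgue_integral_eq_integral(2)[OF abs] by (simp add: set_lebesgue_integral_def)
  also have "\<dots> = 0" using int by (rule integral_unique)
  finally have "AE x in lebesgue. indicator S x *\<^sub>R f x = 0"
    using abs nonneg
    by (subst (asm) integral_nonneg_eq_0_iff_AE) (auto simp: set_integrable_def indicator_def)
  then show ?thesis by (rule AE_mp) (auto simp: indicator_def)
qed

text \<open>
  The functions orthogonal to all exponentials are stable under multiplication by \<open>Re w\<close> and \<open>Im w\<close>,
  which are combinations of two exponentials, hence by every polynomial in them.
\<close>
lemma trig_annihilator_polynomial:
  fixes \<psi> :: "real \<Rightarrow> complex"
  assumes "real_polynomial_function p"
    and "\<And>k. ((\<lambda>x. \<psi> x * expi k x) has_integral 0) {0..1}"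
  shows "((\<lambda>x. \<psi> x * of_real (p (expi 1 x)) * expi k x) has_integral 0) {0..1}"
  using assms
proof (induction p arbitrary: \<psi> k rule: real_polynomial_function.induct)
  case (linear f)
  interpret f: bounded_linear f by fact
  define A B where "A = (of_real (f 1) - \<i> * of_real (f \<i>)) / 2"
    and "B = (of_real (f 1) + \<i> * of_real (f \<i>)) / 2"
  have f_eq: "of_real (f z) = A * z + B * cnj z" for z
  proof -
    have "f z = f (Re z *\<^sub>R 1 + Im z *\<^sub>R \<i>)" by (rule arg_cong[of _ _ f]) (simp add: complex_eq_iff)
    then have "f z = Re z * f 1 + Im z * f \<i>" unfolding f.add f.scale by simp
    then show ?thesis by (simp add: A_def B_def complex_eq_iff field_simps)
  qed
  have "((\<lambda>x. A * (\<psi> x * expi (1 + k) x) + B * (\<psi> x * expi (- 1 + k) x)) has_integral A * 0 + B * 0) {0..1}"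
    by (intro has_integral_add has_integral_mult_right linear.prems)
  then show ?case unfolding f_eq cnj_expi expi_add by (simp add: algebra_simps)
next
  case (const c)
  have "((\<lambda>x. of_real c * (\<psi> x * expi k x)) has_integral of_real c * 0) {0..1}"
    by (intro has_integral_mult_right const.prems)
  then show ?case by (simp add: algebra_simps)
next
  case (add f g)
  have "((\<lambda>x. \<psi> x * of_real (f (expi 1 x)) * expi k x + \<psi> x * of_real (g (expi 1 x)) * expi k x) has_integral 0 + 0) {0..1}"
    by (intro has_integral_add add.IH add.prems)
  then show ?case by (simp add: algebra_simps)
next
  case (mult f g)
  have "((\<lambda>x. (\<psi> x * of_real (f (expi 1 x))) * of_real (g (expi 1 x)) * expi k x) has_integral 0) {0..1}"
    by (rule mult.IH(2)) (rule mult.IH(1), rule mult.prems)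
  then show ?case by (simp add: mult_ac)
qed

lemma expi_1_eq_iff:
  assumes "x \<in> {0..1}" "y \<in> {0<..<1}"
  shows "expi 1 x = expi 1 y \<longleftrightarrow> x = y"
proof
  assume "expi 1 x = expi 1 y"
  then obtain n :: int where "2 * pi * \<i> * of_real x = 2 * pi * \<i> * of_real y + (of_int (2 * n) * pi) * \<i>"
    by (auto simp: expi_def exp_eq)
  then have "2 * pi * x = 2 * pi * y + 2 * pi * n"
    by (auto simp: complex_eq_iff)
  then have "2 * pi * x = 2 * pi * (y + n)" by (simp only: distrib_left)
  then have "x = y + n" by simp
  then show "x = y" using assms by auto
qed simp

text \<open>
  The indicator of a compact set \<open>C\<close> in the circle is the bounded limit of the continuous functions
  \<open>max 0 (1 - n * infdist z C)\<close>, and these are approximated by polynomials due to Stone-Weierstrass.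
  Staying away from the end points \<open>0\<close> and \<open>1\<close> makes \<open>K\<close> the full preimage of its image \<open>C\<close>.
\<close>
lemma trig_annihilator_closed:
  fixes d :: "real \<Rightarrow> real"
  assumes bound: "\<And>x. x \<in> {0..1} \<Longrightarrow> \<bar>d x\<bar> \<le> 1"
    and zero: "\<And>k. ((\<lambda>x. of_real (d x) * expi k x) has_integral 0) {0..1}"
    and K: "closed K" "K \<subseteq> {0<..<1}"
  shows "((\<lambda>x. d x * indicator K x) has_integral 0) {0..1}"
proof (cases "K = {}")
  case True
  then show ?thesis by simp
next
  case False
  define C where "C = expi 1 ` K"
  have "K \<subseteq> {0..1}" using K(2) by auto
  then have "bounded K" by (rule bounded_subset[OF bounded_closed_interval])
  then have "compact K" using K(1) by (simp add: compact_eq_bounded_closed)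
  then have "compact C" unfolding C_def by (rule compact_continuous_image[OF continuous_on_expi])
  then have C: "closed C" "C \<noteq> {}"
    using False by (simp_all add: compact_imp_closed C_def)
  have in_C: "expi 1 x \<in> C \<longleftrightarrow> x \<in> K" if "x \<in> {0..1}" for x
    unfolding C_def image_iff using expi_1_eq_iff[OF that] K(2) by blast
  define H where "H n z = max 0 (1 - real n * infdist z C)" for n z
  have "\<exists>p. real_polynomial_function p \<and> (\<forall>z\<in>sphere 0 1. \<bar>H n z - p z\<bar> < 1 / real (Suc n))" for n
  proof -
    have cont: "continuous_on (sphere 0 1) (H n)" unfolding H_def by (intro continuous_intros)
    have e: "0 < 1 / real (Suc n)" by simp
    show ?thesis
    proof (rule Stone_Weierstrass_real_polynomial_function[OF compact_sphere cont e])
      fix q assume "real_polynomial_function q" "\<And>z. z \<in> sphere 0 1 \<Longrightarrow> \<bar>H n z - q z\<bar> < 1 / real (Suc n)"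
      then show ?thesis by blast
    qed
  qed
  from choice[OF allI[OF this]] obtain p where
    *: "\<forall>n. real_polynomial_function (p n) \<and> (\<forall>z\<in>sphere 0 1. \<bar>H n z - p n z\<bar> < 1 / real (Suc n))" ..
  have p: "real_polynomial_function (p n)" for n using * by blast
  have pH: "\<bar>H n z - p n z\<bar> < 1 / real (Suc n)" if "z \<in> sphere 0 1" for n z using * that by blast
  show ?thesis
  proof (rule has_integral_dominated_convergence)
    show "((\<lambda>x. d x * p n (expi 1 x)) has_integral 0) {0..1}" for n
    proof -
      have "((\<lambda>x. of_real (d x) * of_real (p n (expi 1 x)) * expi 0 x) has_integral 0) {0..1}"
        by (rule trig_annihilator_polynomial[OF p zero])
      then have "((\<lambda>x. Re (of_real (d x) * of_real (p n (expi 1 x)) * expi 0 x)) has_integral Re 0) {0..1}"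
        by (rule has_integral_linear[OF _ bounded_linear_Re, unfolded o_def])
      then show ?thesis by simp
    qed
    show "(\<lambda>x. 2) integrable_on {0..1::real}" by (rule integrable_const_ivl)
    show "\<forall>x\<in>{0..1}. norm (d x * p n (expi 1 x)) \<le> 2" for n
    proof
      fix x :: real assume x: "x \<in> {0..1}"
      have "0 \<le> H n (expi 1 x)" "H n (expi 1 x) \<le> 1" by (simp_all add: H_def infdist_nonneg)
      moreover have "1 / real (Suc n) \<le> 1" by simp
      moreover have "\<bar>H n (expi 1 x) - p n (expi 1 x)\<bar> < 1 / real (Suc n)" by (rule pH) simp
      ultimately have "\<bar>p n (expi 1 x)\<bar> \<le> 2" by linarith
      then have "\<bar>d x\<bar> * \<bar>p n (expi 1 x)\<bar> \<le> 1 * 2" using bound[OF x] by (intro mult_mono) simp_all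
      then show "norm (d x * p n (expi 1 x)) \<le> 2" by (simp add: abs_mult)
    qed
    show "\<forall>x\<in>{0..1}. (\<lambda>n. d x * p n (expi 1 x)) \<longlonglongrightarrow> d x * indicator K x"
    proof
      fix x :: real assume x: "x \<in> {0..1}"
      have "(\<lambda>n. H n (expi 1 x)) \<longlonglongrightarrow> indicator K x"
      proof (cases "x \<in> K")
        case True
        then have "infdist (expi 1 x) C = 0" using in_C[OF x] by simp
        then show ?thesis using True by (simp add: H_def)
      next
        case False
        then have pos: "0 < infdist (expi 1 x) C"
          using infdist_pos_not_in_closed[OF C] in_C[OF x] by blast
        obtain N where N: "1 / infdist (expi 1 x) C < real N" using reals_Archimedean2 by blast
        have "eventually (\<lambda>n. H n (expi 1 x) = 0) sequentially"
          using eventually_ge_at_top[of N]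
        proof eventually_elim
          case (elim n)
          then have "1 / infdist (expi 1 x) C < real n" using N by linarith
          then have "1 < real n * infdist (expi 1 x) C" using pos by (simp add: pos_divide_less_eq)
          then show ?case by (simp add: H_def)
        qed
        then show ?thesis using False by (simp add: tendsto_eventually)
      qed
      moreover have "(\<lambda>n. H n (expi 1 x) - p n (expi 1 x)) \<longlonglongrightarrow> 0"
      proof (rule Lim_null_comparison)
        have "norm (H n (expi 1 x) - p n (expi 1 x)) \<le> 1 / real (Suc n)" for n
          unfolding real_norm_def by (rule less_imp_le, rule pH) simp
        then show "eventually (\<lambda>n. norm (H n (expi 1 x) - p n (expi 1 x)) \<le> 1 / real (Suc n)) sequentially"
          by (intro always_eventually allI)
        show "(\<lambda>n. 1 / real (Suc n)) \<longlonglongrightarrow> 0" by (rule lim_1_over_n[THEN LIMSEQ_Suc])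
      qed
      ultimately have "(\<lambda>n. H n (expi 1 x) - (H n (expi 1 x) - p n (expi 1 x))) \<longlonglongrightarrow> indicator K x - 0"
        by (rule tendsto_diff)
      moreover have "H n (expi 1 x) - (H n (expi 1 x) - p n (expi 1 x)) = p n (expi 1 x)" for n
        by linarith
      ultimately have "(\<lambda>n. p n (expi 1 x)) \<longlonglongrightarrow> indicator K x" by (simp only: diff_zero)
      then show "(\<lambda>n. d x * p n (expi 1 x)) \<longlonglongrightarrow> d x * indicator K x" by (rule tendsto_mult_left)
    qed
    show "(\<lambda>n::nat. 0::real) \<longlonglongrightarrow> 0" by (rule tendsto_const)
  qed
qed

text \<open>
  A closed subset of \<open>{x. 0 < d x}\<close> is null, because \<open>d\<close> has integral zero over it; conclude by inner
  regularity.
\<close>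
lemma trig_annihilator_positive_null:
  fixes d :: "real \<Rightarrow> real"
  assumes bound: "\<And>x. x \<in> {0..1} \<Longrightarrow> \<bar>d x\<bar> \<le> 1"
    and zero: "\<And>k. ((\<lambda>x. of_real (d x) * expi k x) has_integral 0) {0..1}"
  shows "negligible {x \<in> {0<..<1}. 0 < d x}"
proof -
  let ?D = "{x \<in> {0<..<1}. 0 < d x}"
  have "((\<lambda>x. Re (of_real (d x) * expi 0 x)) has_integral Re 0) {0..1}"
    using zero[of 0] by (rule has_integral_linear[OF _ bounded_linear_Re, unfolded o_def])
  then have "(d has_integral 0) {0..1}" by simp
  then have "d integrable_on {0..1}" by (rule has_integral_integrable)
  then have "d \<in> borel_measurable (lebesgue_on {0..1})" by (rule integrable_imp_measurable)
  then have "{x \<in> space (lebesgue_on {0..1}). 0 < d x} \<in> sets (lebesgue_on {0..1})"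
    by (rule borel_measurable_less[OF borel_measurable_const])
  then have "{x \<in> space (lebesgue_on {0..1}). 0 < d x} \<in> sets lebesgue"
    by (subst (asm) sets_restrict_space_iff) (simp, elim conjE)
  moreover have "{0<..<1::real} \<in> sets lebesgue" by simp
  ultimately have "{x \<in> space (lebesgue_on {0..1}). 0 < d x} \<inter> {0<..<1} \<in> sets lebesgue" by (rule sets.Int)
  also have "{x \<in> space (lebesgue_on {0..1}). 0 < d x} \<inter> {0<..<1} = ?D"
    unfolding space_restrict_space by auto
  finally have D: "?D \<in> sets lebesgue" .
  have small: "emeasure lebesgue ?D \<le> ennreal e" if "e > 0" for e
  proof -
    obtain K where K: "closed K" "K \<subseteq> ?D" "?D - K \<in> lmeasurable" "emeasure lebesgue (?D - K) < ennreal e"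
      by (rule sets_lebesgue_inner_closed[OF D \<open>e > 0\<close>])
    have "K \<in> sets lborel" unfolding sets_lborel by (rule borel_closed[OF K(1)])
    then have Ks: "K \<in> sets lebesgue" by (rule sets_completionI_sets)
    have int: "((\<lambda>x. d x * indicator K x) has_integral 0) {0..1}"
    proof (rule trig_annihilator_closed[OF bound zero K(1)])
      show "K \<subseteq> {0<..<1}" using K(2) by blast
    qed
    have "AE x in lebesgue. x \<in> {0..1} \<longrightarrow> d x * indicator K x = 0"
    proof (rule AE_zero_if_integral_zero[OF int])
      fix x show "0 \<le> d x * indicator K x"
      proof (cases "x \<in> K")
        case True
        then have "x \<in> ?D" using K(2) by blast
        then show ?thesis using True by simp
      qed simp
    qed
    then have "AE x in lebesgue. x \<notin> K"
    proof eventually_elim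
      case (elim x)
      show "x \<notin> K"
      proof
        assume "x \<in> K"
        then have "x \<in> ?D" using K(2) by blast
        then show False using elim \<open>x \<in> K\<close> by simp
      qed
    qed
    then have K0: "emeasure lebesgue K = 0"
      by (rule null_setsD1[OF iffD2[OF AE_iff_null_sets[OF Ks]]])
    have "emeasure lebesgue ?D = emeasure lebesgue ((?D - K) \<union> K)"
      by (simp only: Un_Diff_cancel2 Un_absorb2[OF K(2)])
    also have "\<dots> \<le> emeasure lebesgue (?D - K) + emeasure lebesgue K"
      by (rule emeasure_subadditive[OF sets.Diff[OF D Ks] Ks])
    also have "\<dots> \<le> ennreal e" unfolding K0 add_0_right using K(4) by (rule less_imp_le)
    finally show ?thesis .
  qed
  have "emeasure lebesgue ?D \<le> 0"
    by (rule ennreal_le_epsilon) (simp only: add_0 small)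
  then show ?thesis unfolding negligible_iff_emeasure0[OF D] le_zero_eq .
qed

lemma fourier_transform_diff_annihilates:
  assumes u: "is_fourier_transform u c" and v: "is_fourier_transform v c"
  shows "((\<lambda>x. of_real (u x - v x) * expi k x) has_integral 0) {0..1}"
proof -
  have *: "((\<lambda>x. of_real (w x) * expi k x) has_integral c (- k)) {0..1}"
    if "is_fourier_transform w c" for w
  proof -
    have "((\<lambda>x. of_real (w x) * exp (- (2 * pi * \<i> * of_int (- k) * of_real x))) has_integral c (- k)) {0..1}"
      using conjunct2[OF that[unfolded is_fourier_transform_def]] by (rule spec)
    then show ?thesis unfolding expi_minus[symmetric] minus_minus .
  qed
  from has_integral_diff[OF *[OF u] *[OF v]] show ?thesis
    by (simp only: of_real_diff left_diff_distrib diff_self)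
qed

lemma fourier_transform_diff_bounded:
  assumes u: "is_fourier_transform u c" and v: "is_fourier_transform v c" and x: "x \<in> {0..1}"
  shows "\<bar>u x - v x\<bar> \<le> 1"
proof -
  have "u x \<in> {0..1}" "v x \<in> {0..1}"
    using bspec[OF conjunct1[OF u[unfolded is_fourier_transform_def]] x]
      bspec[OF conjunct1[OF v[unfolded is_fourier_transform_def]] x] .
  then show ?thesis unfolding atLeastAtMost_iff by linarith
qed

lemma fourier_transform_AE_le:
  assumes "is_fourier_transform u c" "is_fourier_transform v c"
  shows "AE x in lebesgue. x \<in> {0<..<1} \<longrightarrow> u x \<le> v x"
proof -
  have "negligible {x \<in> {0<..<1}. 0 < u x - v x}"
    by (rule trig_annihilator_positive_null[OF fourier_transform_diff_bounded[OF assms]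
        fourier_transform_diff_annihilates[OF assms]])
  then have "AE x in lebesgue. x \<notin> {x \<in> {0<..<1}. 0 < u x - v x}"
    unfolding negligible_iff_null_sets by (rule AE_not_in)
  then show ?thesis by eventually_elim auto
qed

theorem fourier_transform_unique:
  assumes "is_fourier_transform f c" "is_fourier_transform g c"
  shows "AE x in lebesgue_on {0..1}. g x = f x"
proof -
  have "negligible {0, 1::real}" by (rule negligible_finite) simp
  then have "AE x in lebesgue. x \<notin> {0, 1::real}"
    unfolding negligible_iff_null_sets by (rule AE_not_in)
  with fourier_transform_AE_le[OF assms] fourier_transform_AE_le[OF assms(2,1)]
  have ae: "AE x in lebesgue. x \<in> {0..1} \<longrightarrow> g x = f x"
  proof eventually_elim
    case (elim x)
    show ?case
    proof
      assume "x \<in> {0..1}"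
      then have "x \<in> {0<..<1}" using elim(3) by simp
      then show "g x = f x" using elim(1,2) by simp
    qed
  qed
  have "{0..1::real} \<inter> space lebesgue \<in> sets lebesgue" by simp
  then show ?thesis using ae by (rule AE_restrict_space_iff[THEN iffD2])
qed

section \<open>The determinantal process of the uniform spanning tree\<close>

lemma helix_constants_golden_ratio:
  assumes \<gamma>: "\<gamma> = (sqrt 5 + 1) / 2"
    and \<eta>: "\<eta> = complex_of_real (\<gamma> powr (3/2) / (4 * sqrt 5)) + \<i> * complex_of_real (\<gamma> powr (-3/2) / (4 * sqrt 5))"
    and \<alpha>: "\<alpha> = complex_of_real ((\<gamma> powr (-3/2) - 1) / 2) + \<i> * complex_of_real ((\<gamma> powr (3/2) - 1) / 2)"
  shows "helix_constants (\<gamma> powr (3/2)) (\<gamma> powr (-3/2)) \<eta> \<alpha>"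
proof
  let ?g = "\<gamma> powr (3/2)" and ?h = "\<gamma> powr (-3/2)"
  have pos: "0 < \<gamma>" unfolding \<gamma> by (simp add: add_pos_pos)
  show "0 < ?g" "0 < ?h" using pos by simp_all
  show gh: "?g * ?h = 1" using pos by (simp add: powr_add[symmetric])
  have g2: "?g\<^sup>2 = sqrt 5 + 2"
  proof -
    have "?g\<^sup>2 = \<gamma> powr (3/2 + 3/2)" unfolding powr_add power2_eq_square ..
    also have "\<dots> = \<gamma> ^ 3" using pos by (simp add: powr_numeral)
    also have "\<dots> = sqrt 5 + 2"
    proof -
      have "(sqrt 5 :: real) * (sqrt 5 * sqrt 5) = 5 * sqrt 5" by simp
      then show ?thesis unfolding \<gamma> by (simp add: power3_eq_cube field_simps)
    qed
    finally show ?thesis .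
  qed
  have "(sqrt 5 + 2) * ?h\<^sup>2 = 1" unfolding g2[symmetric] power_mult_distrib[symmetric] gh by simp
  moreover have "(sqrt 5 + 2) * (sqrt 5 - 2) = (1::real)" by (simp add: algebra_simps)
  ultimately have "(sqrt 5 + 2) * ?h\<^sup>2 = (sqrt 5 + 2) * (sqrt 5 - 2)" by (rule trans[OF _ sym])
  moreover have "sqrt 5 + 2 \<noteq> (0::real)" using real_sqrt_ge_zero[of 5] by linarith
  ultimately have "?h\<^sup>2 = sqrt 5 - 2" by (simp only: mult_cancel_left simp_thms)
  then show "?g\<^sup>2 = ?h\<^sup>2 + 4" using g2 by simp
  show "\<eta> = Complex (?g / (4 * sqrt 5)) (?h / (4 * sqrt 5))"
    unfolding \<eta> complex_eq_iff by simp
  show "\<alpha> = Complex ((?h - 1) / 2) ((?g - 1) / 2)"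
    unfolding \<alpha> complex_eq_iff by simp
qed

lemma of_real_set_det: "of_real (set_det I A) = set_det I (\<lambda>i j. of_real (A i j))"
  by (simp add: set_det_def)

lemma det_restricted_matrix:
  assumes "finite S"
  shows "Determinant.det (restricted_matrix A S) = set_det S A"
  unfolding restricted_matrix_def
proof (rule det_eq_set_det)
  show "bij_betw ((!) (sorted_list_of_set S)) {0..<card S} S"
    using assms by (intro bij_betw_nth) (auto simp: atLeast0LessThan)
qed

text \<open>
  That \<open>T\<close> contains \<open>z_edge ` S\<close> depends only on these finitely many edges, so its probability is the
  limit of the probabilities in the boxes.
\<close>
lemma helix3_ust_prob_forced:
  fixes M :: "'a measure"
  assumes "helix3_ust M T" "finite S"
    and lim: "(\<lambda>n. measure_pmf.prob (pmf_of_set (spanning_trees (helix3_sub (- int n) (int n)))) {t. z_edge ` S \<subseteq> t})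
      \<longlonglongrightarrow> L"
  shows "measure M {\<omega>\<in>space M. z_edge ` S \<subseteq> T \<omega>} = L"
proof -
  let ?F = "z_edge ` S"
  have "(\<lambda>n. measure_pmf.prob (pmf_of_set (spanning_trees (helix3_sub (- int n) (int n)))) {t. t \<inter> ?F \<in> {?F}})
      \<longlonglongrightarrow> measure M {\<omega>\<in>space M. T \<omega> \<inter> ?F \<in> {?F}}"
    using assms(1) unfolding helix3_ust_def
    by (elim conjE allE[of _ ?F] allE[of _ "{?F}"] impE) (use assms(2) in \<open>auto simp: helix3_def\<close>)
  moreover have "t \<inter> ?F \<in> {?F} \<longleftrightarrow> ?F \<subseteq> t" for t :: "int edge set" by blast
  ultimately show ?thesis using LIMSEQ_unique[OF _ lim] by simp
qed

theorem theorem1p8: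
  fixes M :: "'a measure" and T :: "'a \<Rightarrow> int edge set" and X :: "int \<Rightarrow> 'a \<Rightarrow> nat"
    and \<gamma> :: real and \<eta> \<alpha> :: complex
    and fhat :: "int \<Rightarrow> complex" and A :: "int \<Rightarrow> int \<Rightarrow> complex" and f :: "real \<Rightarrow> real"
  assumes "prob_space M"
    and "helix3_ust M T"
    and "\<And>m \<omega>. X m \<omega> = of_bool (z_edge m \<in> T \<omega>)"
    and "\<gamma> = (sqrt 5 + 1) / 2"
    and "\<eta> = complex_of_real (\<gamma> powr (3/2) / (4 * sqrt 5))
             + \<i> * complex_of_real (\<gamma> powr (-3/2) / (4 * sqrt 5))"
    and "\<alpha> = complex_of_real ((\<gamma> powr (-3/2) - 1) / 2)
             + \<i> * complex_of_real ((\<gamma> powr (3/2) - 1) / 2)"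
    and "\<And>m. fhat m = \<eta> * \<alpha> ^ nat \<bar>m\<bar> + cnj \<eta> * cnj \<alpha> ^ nat \<bar>m\<bar>"
    and "\<And>k l. A k l = fhat (l - k)"
    and "\<And>x. f x = 1 / (4 + 4 * cos (2 * pi * x) + 2 * cos (4 * pi * x))"
  shows "(\<forall>k l. A k l \<in> \<real> \<and> A l k = A k l) \<and> determinantal_process M X A \<and>
         is_fourier_transform f fhat \<and>
         (\<forall>g. is_fourier_transform g fhat \<longrightarrow> (AE x in lebesgue_on {0..1}. g x = f x))"
proof -
  interpret helix_constants "\<gamma> powr (3/2)" "\<gamma> powr (-3/2)" \<eta> \<alpha>
    by (rule helix_constants_golden_ratio[OF assms(4-6)])
  have fhat: "fhat m = of_real (fcoeff m)" for m
    unfolding assms(7) of_real_fcoeff ..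
  have A: "A k l = of_real (fcoeff (l - k))" for k l
    unfolding assms(8) fhat ..
  have sym: "A l k = A k l" for k l
    unfolding A using fcoeff_minus[of "l - k"] by simp
  have "determinantal_process M X A"
    unfolding determinantal_process_def
  proof (intro conjI allI impI)
    fix m
    have "z_edge m \<in> snd helix3" by (simp add: helix3_def)
    then have meas: "{\<omega>\<in>space M. z_edge m \<in> T \<omega>} \<in> sets M"
      using assms(2) unfolding helix3_ust_def by blast
    have "X m -` {1} \<inter> space M = {\<omega>\<in>space M. z_edge m \<in> T \<omega>}"
         "X m -` {0} \<inter> space M = space M - {\<omega>\<in>space M. z_edge m \<in> T \<omega>}"
      by (auto simp: assms(3) of_bool_def split: if_splits)
    then have "X m -` {1} \<inter> space M \<in> sets M" "X m -` {0} \<inter> space M \<in> sets M"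
      using meas by simp_all
    moreover have "X m \<in> space M \<rightarrow> {0, 1}" by (auto simp: assms(3))
    ultimately show "X m \<in> measurable M (count_space {0, 1})"
      by (simp add: measurable_count_space_eq2)
  next
    fix i j show "A j i = cnj (A i j)" unfolding sym[of i j] by (simp add: A)
  next
    fix S :: "int set" assume S: "finite S"
    have "{\<omega>\<in>space M. \<forall>s\<in>S. X s \<omega> = 1} = {\<omega>\<in>space M. z_edge ` S \<subseteq> T \<omega>}"
      by (auto simp: assms(3))
    then have "measure M {\<omega>\<in>space M. \<forall>s\<in>S. X s \<omega> = 1} = set_det S (\<lambda>i j. fcoeff (j - i))"
      using helix3_ust_prob_forced[OF assms(2) S ust_helix3_limit[OF fcoeff_recurrence fcoeff_at_top fcoeff_at_bot S]]
      by simp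
    also have "complex_of_real \<dots> = set_det S A"
      unfolding of_real_set_det A[symmetric] ..
    also have "\<dots> = Determinant.det (restricted_matrix A S)"
      by (rule det_restricted_matrix[OF S, symmetric])
    finally show "complex_of_real (measure M {\<omega>\<in>space M. \<forall>s\<in>S. X s \<omega> = 1}) = Determinant.det (restricted_matrix A S)" .
  qed
  moreover have ft: "is_fourier_transform f fhat"
    unfolding is_fourier_transform_def
  proof (intro conjI allI ballI)
    fix x :: real
    have "cos (4 * pi * x) = 2 * (cos (2 * pi * x))\<^sup>2 - 1"
      using cos_double_cos[of "2 * pi * x"] by (simp add: mult_ac)
    then have "4 + 4 * cos (2 * pi * x) + 2 * cos (4 * pi * x) = 1 + (1 + 2 * cos (2 * pi * x))\<^sup>2"
      by (simp add: power2_eq_square algebra_simps)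
    then have "f x = 1 / (1 + (1 + 2 * cos (2 * pi * x))\<^sup>2)" unfolding assms(9) by (rule arg_cong)
    moreover have "0 < 1 + (1 + 2 * cos (2 * pi * x))\<^sup>2" by (rule add_pos_nonneg) simp_all
    ultimately show "f x \<in> {0..1}" by (simp add: divide_le_eq)
  next
    fix k
    show "((\<lambda>x. complex_of_real (f x) * exp (- (2 * pi * \<i> * of_int k * of_real x))) has_integral fhat k) {0..1}"
      using has_integral_fourier_fcoeff[of k] unfolding fhat assms(9) expi_minus .
  qed
  moreover have "\<forall>g. is_fourier_transform g fhat \<longrightarrow> (AE x in lebesgue_on {0..1}. g x = f x)"
    using fourier_transform_unique[OF ft] by blast
  moreover have "\<forall>k l. A k l \<in> \<real> \<and> A l k = A k l"
    using sym by (simp add: A)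
  ultimately show ?thesis by blast
qed

end
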